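(* Let $\mathcal{H}$ be a finite-dimensional complex Hilbert space. Let $\Theta,\Lambda\in H^{\infty}(L(\mathcal{H}))$ be two pure inner functions and assume that there exist conjugations $J_{\Theta}$, $J_{\Lambda}$ in $\mathcal{H}$ such that $\Theta$ is $J_{\Theta}$-symmetric and $\Lambda$ is $J_{\Lambda}$-symmetric. Moreover, let $\mathbf{C}$ be a conjugation in $L^2(\mathcal{H})$ with $\mathbf{C}\mathbf{M}_z=\mathbf{M}_{\bar z}\mathbf{C}$. Then $\mathbf{C}(K_{\Lambda})\subset K_\Theta$ if and only if $\mathbf{C}=\mathbf{C}_{\Gamma,J}$ for some inner function $\Gamma\in H^{\infty}(L(\mathcal{H}))$ and some conjugation $J$ in $\mathcal{H}$ such that $\Lambda\leqslant\Gamma\leqslant\Theta$ and $\Gamma$ is $J$-symmetric. In particular, then $\Lambda\leqslant\Theta$.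
   Context: $\mathbb{T}$ is the unit circle with normalized Lebesgue measure, $\mathbb{D}$ the open unit disc. A conjugation on a Hilbert space $\mathcal{K}$ is an antilinear map $C$ with $C^2=I$ and $\langle Cf,Cg\rangle=\langle g,f\rangle$; a bounded linear $A$ is $C$-symmetric if $CAC=A^*$. $L^2(\mathcal{H})$ is the Hilbert space of measurable square-integrable functions $\mathbb{T}\to\mathcal{H}$; $H^2(\mathcal{H})$ is its subspace of functions whose Fourier coefficients of negative index vanish. $H^\infty(L(\mathcal{H}))$ is the space of essentially bounded measurable functions $\mathbb{T}\to L(\mathcal{H})$ ($L(\mathcal{H})$ = bounded linear operators) with vanishing negative Fourier coefficients, each identified with the bounded analytic function $\mathbf{F}(\lambda)=\sum_{n\ge0}F_n\lambda^n$ on $\mathbb{D}$. $(\mathbf{M}_z\mathbf{f})(z)=z\mathbf{f}(z)$, $(\mathbf{M}_{\bar z}\mathbf{f})(z)=\bar z\mathbf{f}(z)$. An inner function is $\Theta\in H^\infty(L(\mathcal{H}))$ with $\Theta(z)$ unitary for almost all $z\in\mathbb{T}$; it is pure if $\|\Theta(0)\|<1$. $K_\Theta=H^2(\mathcal{H})\ominus\Theta H^2(\mathcal{H})$. An inner $\Theta$ is called $J$-symmetric, for a conjugation $J$ in $\mathcal{H}$, if $J\Theta(z)J=\Theta(z)^*$ for almost all $z\in\mathbb{T}$ (equivalently $J\Theta(\lambda)J=\Theta(\lambda)^*$ for all $\lambda\in\mathbb{D}$). For inner functions, $\Lambda\leqslant\Theta$ means $\Lambda^*\Theta\in H^\infty(L(\mathcal{H}))$,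 where $\Lambda^*(z)=\Lambda(z)^*$ a.e. For $\Gamma$ inner and $J$-symmetric, $\mathbf{C}_{\Gamma,J}$ is the conjugation on $L^2(\mathcal{H})$ given by $(\mathbf{C}_{\Gamma,J}\mathbf{f})(z)=\Gamma(z)\bar zJ(\mathbf{f}(z))$ a.e. *)

theory Defs
  imports "HOL-Analysis.Analysis"
begin

class scaleC =
  fixes scaleC :: "complex \<Rightarrow> 'a \<Rightarrow> 'a"  (infixr "*\<^sub>C" 75)

(* The inner product is linear in the first and antilinear in the second argument.  Norm and
   topology come from real_inner; positive definiteness follows from inner_eq_Re_cinner. *)
class complex_inner = real_inner + scaleC +
  fixes cinner :: "'a \<Rightarrow> 'a \<Rightarrow> complex"
  assumes scaleC_add_right: "a *\<^sub>C (x + y) = a *\<^sub>C x + a *\<^sub>C y"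
    and scaleC_add_left: "(a + b) *\<^sub>C x = a *\<^sub>C x + b *\<^sub>C x"
    and scaleC_scaleC: "a *\<^sub>C b *\<^sub>C x = (a * b) *\<^sub>C x"
    and scaleC_of_real: "complex_of_real r *\<^sub>C x = r *\<^sub>R x"
    and cinner_commute: "cinner x y = cnj (cinner y x)"
    and cinner_add_left: "cinner (x + y) z = cinner x z + cinner y z"
    and cinner_scaleC_left: "cinner (a *\<^sub>C x) y = a * cinner x y"
    and inner_eq_Re_cinner: "inner x y = Re (cinner x y)"

(* Completeness and second countability are automatic in finite dimension; they are listed
   because Bochner integration asks for these sorts.  The zero space is not excluded. *)
class fd_complex_hilbert = complex_inner + banach + second_countable_topology +
  assumes finite_dim: "\<exists>B. finite B \<and> (\<forall>x. \<exists>c. x = (\<Sum>b\<in>B. c b *\<^sub>C b))"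

instantiation complex :: complex_inner
begin
definition scaleC_complex :: "complex \<Rightarrow> complex \<Rightarrow> complex"
  where "scaleC_complex a x = a * x"
definition cinner_complex :: "complex \<Rightarrow> complex \<Rightarrow> complex"
  where "cinner_complex x y = x * cnj y"
instance
  by standard (auto simp: scaleC_complex_def cinner_complex_def algebra_simps scaleR_conv_of_real
      inner_complex_def)
end

instantiation vec :: (complex_inner, finite) complex_inner
begin
definition scaleC_vec :: "complex \<Rightarrow> 'a ^ 'b \<Rightarrow> 'a ^ 'b"
  where "scaleC_vec a x = (\<chi> i. a *\<^sub>C (x $ i))"
definition cinner_vec :: "'a ^ 'b \<Rightarrow> 'a ^ 'b \<Rightarrow> complex"
  where "cinner_vec x y = (\<Sum>i\<in>UNIV. cinner (x $ i) (y $ i))"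
instance
proof
  fix x y :: "'a ^ 'b"
  show "cinner x y = cnj (cinner y x)"
    unfolding cinner_vec_def cnj_sum by (intro sum.cong refl cinner_commute)
qed (simp_all add: scaleC_vec_def cinner_vec_def vec_eq_iff scaleC_add_right scaleC_add_left
      scaleC_scaleC scaleC_of_real cinner_add_left cinner_scaleC_left sum.distrib sum_distrib_left
      inner_vec_def inner_eq_Re_cinner)
end

instance complex :: fd_complex_hilbert
proof
  have "\<exists>c. x = (\<Sum>b\<in>{1}. c b *\<^sub>C b)" for x :: complex
    by (rule exI[of _ "\<lambda>b. x"]) (simp add: scaleC_complex_def)
  then show "\<exists>B::complex set. finite B \<and> (\<forall>x. \<exists>c. x = (\<Sum>b\<in>B. c b *\<^sub>C b))"
    by (intro exI[of _ "{1}"]) simp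
qed

instance vec :: ("{euclidean_space, fd_complex_hilbert}", finite) fd_complex_hilbert
proof
  obtain B :: "'a set" where B: "finite B" "\<And>x. \<exists>c. x = (\<Sum>b\<in>B. c b *\<^sub>C b)"
    using finite_dim by blast
  let ?D = "(\<lambda>(i :: 'b, b). axis i b) ` (UNIV \<times> (B - {0}))"
  have inj: "inj_on (\<lambda>(i :: 'b, b). axis i b) (UNIV \<times> (B - {0}))"
    by (auto simp: inj_on_def axis_eq_axis)
  have zero: "a *\<^sub>C 0 = (0::'a)" for a
    using scaleC_add_right[of a 0 "0::'a"] by simp
  have axis: "(a *\<^sub>C axis i b) $ j = (if i = j then a *\<^sub>C b else 0)"
    for a and b :: 'a and i j :: 'b
    by (simp add: scaleC_vec_def axis_def zero)
  have "\<exists>c. x = (\<Sum>d\<in>?D. c d *\<^sub>C d)" for x :: "'a ^ 'b"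
  proof -
    have "\<forall>i. \<exists>c. x $ i = (\<Sum>b\<in>B. c b *\<^sub>C b)"
      by (intro allI B(2))
    then obtain k where k: "\<And>i. x $ i = (\<Sum>b\<in>B. k i b *\<^sub>C b)"
      by (auto dest: choice)
    define c where "c d = (case the_inv_into (UNIV \<times> (B - {0})) (\<lambda>(i, b). axis i b) d
      of (i, b) \<Rightarrow> k i b)" for d :: "'a ^ 'b"
    have c: "c (axis i b) = k i b" if "b \<in> B - {0}" for i b
      using the_inv_into_f_f[OF inj, of "(i, b)"] that by (simp add: c_def)
    have "(\<Sum>d\<in>?D. c d *\<^sub>C d) $ j = x $ j" for j
    proof -
      have "(\<Sum>d\<in>?D. c d *\<^sub>C d) $ j
          = (\<Sum>(i, b)\<in>UNIV \<times> (B - {0}). (c (axis i b) *\<^sub>C axis i b) $ j)"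
        by (subst sum.reindex[OF inj]) (simp add: case_prod_unfold)
      also have "\<dots> = (\<Sum>i\<in>UNIV. \<Sum>b\<in>B - {0}. if i = j then k j b *\<^sub>C b else 0)"
        unfolding sum.cartesian_product
        by (intro sum.cong refl) (simp add: c axis mem_Times_iff case_prod_unfold)
      also have "\<dots> = (\<Sum>i\<in>UNIV. if i = j then (\<Sum>b\<in>B - {0}. k j b *\<^sub>C b) else 0)"
        by (intro sum.cong refl) auto
      also have "\<dots> = (\<Sum>b\<in>B - {0}. k j b *\<^sub>C b)"
        by simp
      also have "\<dots> = x $ j"
        unfolding k by (rule sum.mono_neutral_left) (auto simp: B zero)
      finally show ?thesis .
    qed
    then have "x = (\<Sum>d\<in>?D. c d *\<^sub>C d)"
      by (simp add: vec_eq_iff)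
    then show ?thesis
      by (rule exI[of _ c])
  qed
  moreover have "finite ?D"
    using B by simp
  ultimately show "\<exists>B::('a ^ 'b) set. finite B \<and> (\<forall>x. \<exists>c. x = (\<Sum>b\<in>B. c b *\<^sub>C b))"
    by blast
qed

definition bounded_clinear :: "('h::fd_complex_hilbert \<Rightarrow> 'h) \<Rightarrow> bool"
  where "bounded_clinear A \<longleftrightarrow> bounded_linear A \<and> (\<forall>c x. A (c *\<^sub>C x) = c *\<^sub>C A x)"

definition cadjoint :: "('h::fd_complex_hilbert \<Rightarrow> 'h) \<Rightarrow> 'h \<Rightarrow> 'h"
  where "cadjoint A = (THE B. \<forall>x y. cinner (A x) y = cinner x (B y))"

definition unitary :: "('h::fd_complex_hilbert \<Rightarrow> 'h) \<Rightarrow> bool"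
  where "unitary U \<longleftrightarrow> bounded_clinear U \<and> cadjoint U \<circ> U = id \<and> U \<circ> cadjoint U = id"

definition conjugation :: "('h::fd_complex_hilbert \<Rightarrow> 'h) \<Rightarrow> bool"
  where "conjugation J \<longleftrightarrow>
    (\<forall>x y. J (x + y) = J x + J y) \<and> (\<forall>c x. J (c *\<^sub>C x) = cnj c *\<^sub>C J x) \<and>
    (\<forall>x. J (J x) = x) \<and> (\<forall>x y. cinner (J x) (J y) = cinner y x)"

definition circle :: "complex measure"
  where "circle =
    distr (uniform_measure lborel {0..2 * pi}) (restrict_space borel (sphere 0 1)) cis"

(* Elements of the spaces L2, Linf, ... are represented by functions defined everywhere; only
   their values on the circle matter, and functions equal almost everywhere on it represent
   the same element. *)
definition L2 :: "(complex \<Rightarrow> 'h::fd_complex_hilbert) set"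
  where "L2 = {f \<in> borel_measurable circle. integrable circle (\<lambda>z. (norm (f z))\<^sup>2)}"

definition L2_inner :: "(complex \<Rightarrow> 'h::fd_complex_hilbert) \<Rightarrow> (complex \<Rightarrow> 'h) \<Rightarrow> complex"
  where "L2_inner f g = (LINT z|circle. cinner (f z) (g z))"

definition fourier :: "(complex \<Rightarrow> 'h::fd_complex_hilbert) \<Rightarrow> int \<Rightarrow> 'h"
  where "fourier f n = (LINT z|circle. (cnj z powi n) *\<^sub>C f z)"

definition H2 :: "(complex \<Rightarrow> 'h::fd_complex_hilbert) set"
  where "H2 = {f \<in> L2. \<forall>n<0. fourier f n = 0}"

(* Measurability of an operator-valued function is stated strongly (on each vector); in finite
   dimension this agrees with Borel measurability for the operator norm.  Likewise the Fourier
   coefficient of F at n is the operator mapping x to fourier (\<lambda>z. F z x) n. *)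
definition Linf :: "(complex \<Rightarrow> 'h::fd_complex_hilbert \<Rightarrow> 'h) set"
  where "Linf = {F. (\<forall>z\<in>sphere 0 1. bounded_clinear (F z)) \<and>
    (\<forall>x. (\<lambda>z. F z x) \<in> borel_measurable circle) \<and>
    (\<exists>M. AE z in circle. onorm (F z) \<le> M)}"

definition op_fourier :: "(complex \<Rightarrow> 'h::fd_complex_hilbert \<Rightarrow> 'h) \<Rightarrow> int \<Rightarrow> 'h \<Rightarrow> 'h"
  where "op_fourier F n = (\<lambda>x. fourier (\<lambda>z. F z x) n)"

definition Hinf :: "(complex \<Rightarrow> 'h::fd_complex_hilbert \<Rightarrow> 'h) set"
  where "Hinf = {F \<in> Linf. \<forall>n<0. op_fourier F n = (\<lambda>x. 0)}"

definition disc_extension :: "(complex \<Rightarrow> 'h::fd_complex_hilbert \<Rightarrow> 'h) \<Rightarrow> complex \<Rightarrow> 'h \<Rightarrow> 'h"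
  where "disc_extension F w = (\<lambda>x. \<Sum>n. w ^ n *\<^sub>C op_fourier F (int n) x)"

definition inner_function :: "(complex \<Rightarrow> 'h::fd_complex_hilbert \<Rightarrow> 'h) \<Rightarrow> bool"
  where "inner_function \<Theta> \<longleftrightarrow> \<Theta> \<in> Hinf \<and> (AE z in circle. unitary (\<Theta> z))"

definition pure :: "(complex \<Rightarrow> 'h::fd_complex_hilbert \<Rightarrow> 'h) \<Rightarrow> bool"
  where "pure \<Theta> \<longleftrightarrow> onorm (disc_extension \<Theta> 0) < 1"

definition model_space :: "(complex \<Rightarrow> 'h::fd_complex_hilbert \<Rightarrow> 'h) \<Rightarrow> (complex \<Rightarrow> 'h) set"
  where "model_space \<Theta> = {f \<in> H2. \<forall>g\<in>H2. L2_inner f (\<lambda>z. \<Theta> z (g z)) = 0}"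

definition symmetric_wrt ::
    "('h::fd_complex_hilbert \<Rightarrow> 'h) \<Rightarrow> (complex \<Rightarrow> 'h \<Rightarrow> 'h) \<Rightarrow> bool"
  where "symmetric_wrt J \<Theta> \<longleftrightarrow> (AE z in circle. J \<circ> \<Theta> z \<circ> J = cadjoint (\<Theta> z))"

definition inner_le ::
    "(complex \<Rightarrow> 'h::fd_complex_hilbert \<Rightarrow> 'h) \<Rightarrow> (complex \<Rightarrow> 'h \<Rightarrow> 'h) \<Rightarrow> bool"
  where "inner_le \<Lambda> \<Theta> \<longleftrightarrow> (\<lambda>z. cadjoint (\<Lambda> z) \<circ> \<Theta> z) \<in> Hinf"

definition eq_ae :: "(complex \<Rightarrow> 'h::fd_complex_hilbert) \<Rightarrow> (complex \<Rightarrow> 'h) \<Rightarrow> bool"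
  where "eq_ae f g \<longleftrightarrow> (AE z in circle. f z = g z)"

(* The first two conjuncts say that C induces a map on classes of L2. *)
definition L2_conjugation :: "((complex \<Rightarrow> 'h::fd_complex_hilbert) \<Rightarrow> complex \<Rightarrow> 'h) \<Rightarrow> bool"
  where "L2_conjugation C \<longleftrightarrow>
    (\<forall>f\<in>L2. C f \<in> L2) \<and>
    (\<forall>f\<in>L2. \<forall>g\<in>L2. eq_ae f g \<longrightarrow> eq_ae (C f) (C g)) \<and>
    (\<forall>f\<in>L2. \<forall>g\<in>L2. eq_ae (C (\<lambda>z. f z + g z)) (\<lambda>z. C f z + C g z)) \<and>
    (\<forall>c. \<forall>f\<in>L2. eq_ae (C (\<lambda>z. c *\<^sub>C f z)) (\<lambda>z. cnj c *\<^sub>C C f z)) \<and>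
    (\<forall>f\<in>L2. eq_ae (C (C f)) f) \<and>
    (\<forall>f\<in>L2. \<forall>g\<in>L2. L2_inner (C f) (C g) = L2_inner g f)"

definition Mz :: "(complex \<Rightarrow> 'h::fd_complex_hilbert) \<Rightarrow> complex \<Rightarrow> 'h"
  where "Mz f = (\<lambda>z. z *\<^sub>C f z)"

definition Mzbar :: "(complex \<Rightarrow> 'h::fd_complex_hilbert) \<Rightarrow> complex \<Rightarrow> 'h"
  where "Mzbar f = (\<lambda>z. cnj z *\<^sub>C f z)"

definition model_conj ::
    "(complex \<Rightarrow> 'h::fd_complex_hilbert \<Rightarrow> 'h) \<Rightarrow> ('h \<Rightarrow> 'h) \<Rightarrow> (complex \<Rightarrow> 'h) \<Rightarrow> complex \<Rightarrow> 'h"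
  where "model_conj \<Gamma> J f = (\<lambda>z. \<Gamma> z (cnj z *\<^sub>C J (f z)))"

end

theory Submission
  imports Defs "HOL-Computational_Algebra.Polynomial"
begin

text \<open>
  A conjugation \<open>C\<close> of \<open>L\<^sup>2\<close> with \<open>C M\<^sub>z = M\<^sub>z\<^sup>* C\<close> acts fibre by fibre: for almost every \<open>z\<close> there is a
  conjugation \<open>C\<^sub>z\<close> of the fibre with \<open>(C f)(z) = C\<^sub>z (f z)\<close>.  The reason is that \<open>\<langle>C f, C g\<rangle> = \<langle>g, f\<rangle>\<close> can be
  tested on \<open>z\<^sup>m f\<close> and \<open>z\<^sup>n g\<close>, so uniqueness of Fourier coefficients upgrades it to a pointwise
  identity (\<open>L2_conjugation_pointwise\<close>, \<open>L2_conjugation_fibrewise\<close>).  For an arbitrary conjugation \<open>J\<close> of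
  the fibre, \<open>\<Gamma>(z) = z C\<^sub>z J\<close> is then unitary, \<open>J\<close>-symmetric and gives \<open>C = C\<^sub>\<Gamma>\<^sub>,\<^sub>J\<close>.  The whole content of
  the theorem is therefore analytic: \<open>C\<close> maps \<open>K\<^sub>\<Lambda>\<close> into \<open>K\<^sub>\<Theta>\<close> exactly if \<open>\<Gamma>\<close>, \<open>\<Lambda>\<^sup>* \<Gamma>\<close> and \<open>\<Gamma>\<^sup>* \<Theta>\<close> have no
  negative Fourier coefficients.

  If \<open>\<Lambda> \<le> \<Gamma> \<le> \<Theta>\<close> and \<open>f\<close> is in \<open>K\<^sub>\<Lambda>\<close>, then \<open>C f\<close> has no negative frequencies because \<open>f\<close> is orthogonal to
  \<open>\<Lambda> (\<Lambda>\<^sup>* \<Gamma>) H\<^sup>2\<close>, and it is orthogonal to \<open>\<Theta> H\<^sup>2\<close> because \<open>\<Gamma>\<^sup>* \<Theta>\<close> preserves \<open>H\<^sup>2\<close>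
  (\<open>model_conj_model_space\<close>).

  For the converse take for \<open>J\<close> the conjugation that symmetrises \<open>\<Lambda>\<close>.  The first part, applied with
  \<open>\<Gamma> = \<Lambda> = \<Theta>\<close>, says that the conjugation belonging to \<open>\<Lambda>\<close> preserves \<open>K\<^sub>\<Lambda>\<close>; composing it with \<open>C\<close> gives
  multiplication by \<open>W = \<Gamma> \<Lambda>\<^sup>*\<close>, which thus maps \<open>K\<^sub>\<Lambda>\<close> into \<open>H\<^sup>2\<close>.  Likewise, following \<open>C\<close> by the
  conjugation belonging to \<open>\<Theta>\<close> gives multiplication by \<open>V = \<Theta> J' J \<Gamma>\<^sup>*\<close>.  A bounded multiplier that
  maps \<open>K\<^sub>\<Lambda>\<close> into \<open>H\<^sup>2\<close> is analytic (\<open>Hinf_if_maps_model_space\<close>): \<open>K\<^sub>\<Lambda>\<close> contains the kernels \<open>(I - \<Lambda> A) x\<close> with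
  \<open>A = J \<Lambda>(0) J\<close>, and by purity \<open>I - \<Lambda> A\<close> is invertible among bounded analytic functions.  Finally
  \<open>\<Gamma> = W \<Lambda>\<close>, \<open>\<Lambda>\<^sup>* \<Gamma> = J W\<^sup>* J\<close> and \<open>\<Gamma>\<^sup>* \<Theta> = J V\<^sup>* J'\<close>, and \<open>F \<mapsto> J F\<^sup>* J'\<close> preserves analyticity
  (\<open>Hinf_conjugated_cadjoint\<close>).

  The one fact of function theory behind all products is that two scalar functions in \<open>H\<^sup>2\<close> have a
  product without negative frequencies (\<open>H2_mult_moment\<close>), which rests on the density of
  trigonometric polynomials in \<open>L\<^sup>2\<close>.
\<close>

section \<open>Finite-dimensional complex inner product spaces\<close>

lemma scaleC_one [simp]: "1 *\<^sub>C x = (x::'a::complex_inner)"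
  using scaleC_of_real[of 1 x] by simp

lemma scaleC_zero_left [simp]: "0 *\<^sub>C x = (0::'a::complex_inner)"
  using scaleC_of_real[of 0 x] by simp

lemma scaleC_zero_right [simp]: "a *\<^sub>C 0 = (0::'a::complex_inner)"
  using scaleC_add_right[of a 0 "0::'a"] by simp

lemma scaleC_minus_one: "(-1) *\<^sub>C x = - (x::'a::complex_inner)"
  using scaleC_of_real[of "-1" x] by simp

lemma scaleC_minus_right: "a *\<^sub>C (- x) = - (a *\<^sub>C (x::'a::complex_inner))"
  using scaleC_add_right[of a x "-x"] by (simp add: eq_neg_iff_add_eq_0 add.commute)

lemma scaleC_diff_right: "a *\<^sub>C (x - y) = a *\<^sub>C x - a *\<^sub>C (y::'a::complex_inner)"
  using scaleC_add_right[of a x "-y"] by (simp add: scaleC_minus_right)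

lemma scaleC_sum_right: "a *\<^sub>C (\<Sum>i\<in>I. f i) = (\<Sum>i\<in>I. a *\<^sub>C (f i::'a::complex_inner))"
  by (induction I rule: infinite_finite_induct) (simp_all add: scaleC_add_right)

lemma scaleC_sum_left: "(\<Sum>i\<in>I. f i) *\<^sub>C x = (\<Sum>i\<in>I. f i *\<^sub>C (x::'a::complex_inner))"
  by (induction I rule: infinite_finite_induct) (simp_all add: scaleC_add_left)

lemma scaleC_scaleR_commute: "a *\<^sub>C (r *\<^sub>R x) = r *\<^sub>R (a *\<^sub>C (x::'a::complex_inner))"
  by (simp add: scaleC_of_real[symmetric] scaleC_scaleC mult.commute)

lemma cinner_zero_left [simp]: "cinner 0 (y::'a::complex_inner) = 0"
  using cinner_add_left[of 0 0 y] by simp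

lemma cinner_zero_right [simp]: "cinner (y::'a::complex_inner) 0 = 0"
  using cinner_commute[of y 0] by simp

lemma cinner_minus_left: "cinner (- x) (y::'a::complex_inner) = - cinner x y"
  using cinner_add_left[of x "-x" y] by (simp add: eq_neg_iff_add_eq_0 add.commute)

lemma cinner_diff_left: "cinner (x - z) (y::'a::complex_inner) = cinner x y - cinner z y"
  using cinner_add_left[of x "-z" y] by (simp add: cinner_minus_left)

lemma cinner_add_right: "cinner x (y + z) = cinner x y + cinner x (z::'a::complex_inner)"
  by (metis cinner_add_left cinner_commute complex_cnj_add)

lemma cinner_diff_right: "cinner x (y - z) = cinner x y - cinner x (z::'a::complex_inner)"
  by (metis cinner_diff_left cinner_commute complex_cnj_diff)

lemma cinner_scaleC_right: "cinner x (a *\<^sub>C y) = cnj a * cinner x (y::'a::complex_inner)"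
  by (metis cinner_scaleC_left cinner_commute complex_cnj_mult)

lemma cinner_sum_left: "cinner (\<Sum>i\<in>I. f i) (y::'a::complex_inner) = (\<Sum>i\<in>I. cinner (f i) y)"
  by (induction I rule: infinite_finite_induct) (simp_all add: cinner_add_left)

lemma cinner_sum_right: "cinner (y::'a::complex_inner) (\<Sum>i\<in>I. f i) = (\<Sum>i\<in>I. cinner y (f i))"
  by (induction I rule: infinite_finite_induct) (simp_all add: cinner_add_right)

lemma cinner_self: "cinner x x = complex_of_real ((norm (x::'a::complex_inner))\<^sup>2)"
proof -
  have "Im (cinner x x) = 0"
    using cinner_commute[of x x] by (metis cnj.simps(2) equal_neg_zero)
  then show ?thesis
    by (simp add: complex_eq_iff power2_norm_eq_inner inner_eq_Re_cinner)
qed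

lemma norm_scaleC [simp]: "norm (a *\<^sub>C x) = cmod a * norm (x::'a::complex_inner)"
proof -
  have "complex_of_real ((norm (a *\<^sub>C x))\<^sup>2) = complex_of_real ((cmod a * norm x)\<^sup>2)"
    unfolding cinner_self[symmetric] cinner_scaleC_left cinner_scaleC_right
    by (simp add: cinner_self power_mult_distrib complex_norm_square mult_ac flip: of_real_power)
  then have "(norm (a *\<^sub>C x))\<^sup>2 = (cmod a * norm x)\<^sup>2"
    by (simp only: of_real_eq_iff)
  then show ?thesis
    by (simp add: power2_eq_iff_nonneg)
qed

lemma cinner_eqI: "(\<And>y. cinner x y = cinner x' y) \<Longrightarrow> x = (x'::'a::complex_inner)"
  by (metis inner_eq_Re_cinner vector_eq_rdot)

text \<open>Rotating the first argument by a unimodular factor makes the product real, which reduces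
  the inequality to the one for the real inner product.\<close>

lemma cinner_Cauchy_Schwarz: "cmod (cinner x y) \<le> norm x * norm (y::'a::complex_inner)"
proof (cases "cinner x y = 0")
  case False
  define u where "u = cnj (cinner x y) / cmod (cinner x y)"
  have u: "cmod u = 1"
    using False by (simp add: u_def norm_divide)
  have "u * cinner x y = cmod (cinner x y)"
    using False by (simp add: u_def complex_norm_square[symmetric] power2_eq_square mult.commute
        del: of_real_mult flip: of_real_mult)
      (simp add: field_simps complex_norm_square power2_eq_square flip: of_real_mult)
  then have "cmod (cinner x y) = Re (cinner (u *\<^sub>C x) y)"
    by (simp add: cinner_scaleC_left)
  also have "\<dots> \<le> norm (u *\<^sub>C x) * norm y"
    unfolding inner_eq_Re_cinner[symmetric] by (rule norm_cauchy_schwarz)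
  finally show ?thesis
    by (simp add: u)
qed simp

lemma bounded_bilinear_scaleC: "bounded_bilinear ((*\<^sub>C) :: complex \<Rightarrow> 'a \<Rightarrow> 'a::complex_inner)"
proof
  show "\<exists>K. \<forall>a (b::'a). norm (a *\<^sub>C b) \<le> norm a * norm b * K"
    by (intro exI[of _ 1]) simp
qed (simp_all add: scaleC_add_left scaleC_add_right scaleC_scaleR_commute scaleR_conv_of_real
    scaleC_scaleC[symmetric] scaleC_of_real)

lemma bounded_bilinear_cinner: "bounded_bilinear (cinner :: 'a \<Rightarrow> 'a \<Rightarrow> complex)"
  if "SORT_CONSTRAINT('a::complex_inner)"
proof
  show "\<exists>K. \<forall>a (b::'a). norm (cinner a b) \<le> norm a * norm b * K"
    by (intro exI[of _ 1]) (simp add: cinner_Cauchy_Schwarz)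
  show "cinner (r *\<^sub>R a) b = r *\<^sub>R cinner a b" for r and a b :: 'a
    by (simp add: scaleC_of_real[symmetric, where 'a='a] cinner_scaleC_left scaleR_conv_of_real)
  show "cinner a (r *\<^sub>R b) = r *\<^sub>R cinner a b" for r and a b :: 'a
    by (simp add: scaleC_of_real[symmetric, where 'a='a] cinner_scaleC_right scaleR_conv_of_real)
qed (simp_all add: cinner_add_left cinner_add_right)

lemma borel_measurable_scaleC [measurable (raw)]:
  fixes f :: "'b \<Rightarrow> 'h::fd_complex_hilbert"
  assumes "a \<in> borel_measurable M" and "f \<in> borel_measurable M"
  shows "(\<lambda>z. a z *\<^sub>C f z) \<in> borel_measurable M"
  using assms
  by (rule borel_measurable_continuous_Pair)
    (intro bounded_bilinear.continuous_on[OF bounded_bilinear_scaleC] continuous_intros)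

lemma borel_measurable_cinner [measurable (raw)]:
  fixes f g :: "'b \<Rightarrow> 'h::fd_complex_hilbert"
  assumes "f \<in> borel_measurable M" and "g \<in> borel_measurable M"
  shows "(\<lambda>z. cinner (f z) (g z)) \<in> borel_measurable M"
  using assms
  by (rule borel_measurable_continuous_Pair)
    (intro bounded_bilinear.continuous_on[OF bounded_bilinear_cinner] continuous_intros)

definition orthonormal_basis :: "'h::fd_complex_hilbert set \<Rightarrow> bool"
  where "orthonormal_basis E \<longleftrightarrow> finite E \<and>
    (\<forall>a\<in>E. \<forall>b\<in>E. cinner a b = (if a = b then 1 else 0)) \<and>
    (\<forall>x. x = (\<Sum>e\<in>E. cinner x e *\<^sub>C e))"

text \<open>Gram--Schmidt: each further vector contributes its normalised component orthogonal to the
  system built so far, unless that component vanishes.\<close>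

lemma Gram_Schmidt:
  fixes B :: "'h::fd_complex_hilbert set"
  assumes "finite B"
  shows "\<exists>E. finite E \<and> (\<forall>a\<in>E. \<forall>b\<in>E. cinner a b = (if a = b then 1 else 0)) \<and>
    (\<forall>b\<in>B. b = (\<Sum>e\<in>E. cinner b e *\<^sub>C e))"
  using assms
proof (induction B)
  case empty
  then show ?case
    by (intro exI[of _ "{}"]) simp
next
  case (insert x B)
  then obtain E where E: "finite E"
    and on: "\<And>a b. a \<in> E \<Longrightarrow> b \<in> E \<Longrightarrow> cinner a b = (if a = b then 1 else 0)"
    and ex: "\<And>b. b \<in> B \<Longrightarrow> b = (\<Sum>e\<in>E. cinner b e *\<^sub>C e)"
    by blast
  define p where "p = (\<Sum>e\<in>E. cinner x e *\<^sub>C e)"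
  define v where "v = x - p"
  have pe: "cinner p e = cinner x e" if "e \<in> E" for e
  proof -
    have "cinner p e = (\<Sum>a\<in>E. if a = e then cinner x e else 0)"
      unfolding p_def cinner_sum_left
      by (intro sum.cong refl) (simp add: cinner_scaleC_left on that)
    then show ?thesis
      using E that by simp
  qed
  have ve: "cinner v e = 0" if "e \<in> E" for e
    using pe[OF that] by (simp add: v_def cinner_diff_left)
  show ?case
  proof (cases "v = 0")
    case True
    then have "x = p"
      by (simp add: v_def)
    then show ?thesis
      using E on ex unfolding p_def by (intro exI[of _ E]) auto
  next
    case False
    define u where "u = complex_of_real (1 / norm v) *\<^sub>C v"
    have ue: "cinner u e = 0" if "e \<in> E" for e
      by (simp add: u_def cinner_scaleC_left ve that)
    have eu: "cinner e u = 0" if "e \<in> E" for e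
      using ue[OF that] cinner_commute[of e u] by simp
    have uu: "cinner u u = 1"
      using False by (simp add: cinner_self u_def norm_divide)
    have unE: "u \<notin> E"
      using ue uu by force
    have pu: "cinner p u = 0"
      by (simp add: p_def cinner_sum_left cinner_scaleC_left eu)
    have "cinner x u *\<^sub>C u = (cinner v u) *\<^sub>C u"
      using pu by (simp add: v_def cinner_diff_left)
    also have "\<dots> = v"
      using False by (simp add: u_def cinner_scaleC_right scaleC_scaleC cinner_self power2_eq_square)
    finally have xu: "cinner x u *\<^sub>C u = v" .
    have "x = (\<Sum>e\<in>insert u E. cinner x e *\<^sub>C e)"
      using E unE xu by (simp add: p_def[symmetric]) (simp add: v_def)
    moreover have "b = (\<Sum>e\<in>insert u E. cinner b e *\<^sub>C e)" if "b \<in> B" for b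
    proof -
      have "cinner b u = 0"
        by (subst ex[OF that]) (simp add: cinner_sum_left cinner_scaleC_left eu)
      then show ?thesis
        using E unE ex[OF that] by simp
    qed
    ultimately show ?thesis
      using E on ue eu uu unE by (intro exI[of _ "insert u E"]) auto
  qed
qed

lemma orthonormal_basis_exists: "\<exists>E::'h::fd_complex_hilbert set. orthonormal_basis E"
proof -
  obtain B :: "'h set" where B: "finite B" "\<And>x. \<exists>c. x = (\<Sum>b\<in>B. c b *\<^sub>C b)"
    using finite_dim by blast
  obtain E :: "'h set" where E: "finite E"
    and on: "\<forall>a\<in>E. \<forall>b\<in>E. cinner a b = (if a = b then 1 else 0)"
    and ex: "\<And>b. b \<in> B \<Longrightarrow> b = (\<Sum>e\<in>E. cinner b e *\<^sub>C e)"
    using Gram_Schmidt[OF B(1)] by blast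
  have "x = (\<Sum>e\<in>E. cinner x e *\<^sub>C e)" for x
  proof -
    obtain c where c: "x = (\<Sum>b\<in>B. c b *\<^sub>C b)"
      using B(2) by blast
    have "x = (\<Sum>b\<in>B. c b *\<^sub>C (\<Sum>e\<in>E. cinner b e *\<^sub>C e))"
      unfolding c by (intro sum.cong refl) (simp add: ex[symmetric])
    also have "\<dots> = (\<Sum>e\<in>E. \<Sum>b\<in>B. (c b * cinner b e) *\<^sub>C e)"
      unfolding scaleC_sum_right by (subst sum.swap) (simp add: scaleC_scaleC)
    also have "\<dots> = (\<Sum>e\<in>E. cinner x e *\<^sub>C e)"
      by (simp add: c cinner_sum_left cinner_scaleC_left scaleC_sum_left)
    finally show ?thesis .
  qed
  then show ?thesis
    using E on unfolding orthonormal_basis_def by blast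
qed

lemma orthonormal_basis_cinner:
  assumes "orthonormal_basis E"
  shows "cinner x y = (\<Sum>e\<in>E. cinner x e * cinner e y)"
proof -
  have "cinner x y = cinner (\<Sum>e\<in>E. cinner x e *\<^sub>C e) y"
    using assms unfolding orthonormal_basis_def by metis
  then show ?thesis
    by (simp add: cinner_sum_left cinner_scaleC_left)
qed

lemma clinear_sum:
  assumes "\<And>x y. A (x + y) = A x + A y" and "\<And>c x. A (c *\<^sub>C x) = c *\<^sub>C A x"
  shows "A (\<Sum>i\<in>I. c i *\<^sub>C f i) = (\<Sum>i\<in>I. c i *\<^sub>C (A (f i) :: 'h::fd_complex_hilbert))"
proof -
  have "A 0 = 0"
    using assms(1)[of 0 0] by simp
  then show ?thesis
    by (induction I rule: infinite_finite_induct) (simp_all add: assms)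
qed

lemma bounded_clinearI:
  fixes A :: "'h::fd_complex_hilbert \<Rightarrow> 'h"
  assumes add: "\<And>x y. A (x + y) = A x + A y" and scale: "\<And>c x. A (c *\<^sub>C x) = c *\<^sub>C A x"
  shows "bounded_clinear A"
proof -
  obtain E :: "'h set" where E: "orthonormal_basis E"
    using orthonormal_basis_exists by blast
  have A: "A x = (\<Sum>e\<in>E. cinner x e *\<^sub>C A e)" for x
    using clinear_sum[of A "\<lambda>e. cinner x e" "\<lambda>e. e" E, OF add scale] E
    unfolding orthonormal_basis_def by metis
  have "bounded_linear (\<lambda>x. \<Sum>e\<in>E. cinner x e *\<^sub>C A e)"
    by (intro bounded_linear_sum
        bounded_linear_compose[OF bounded_bilinear.bounded_linear_left[OF bounded_bilinear_scaleC]]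
        bounded_bilinear.bounded_linear_left[OF bounded_bilinear_cinner])
  then show ?thesis
    unfolding A[abs_def, symmetric] bounded_clinear_def using scale by blast
qed

lemma bounded_clinear_add: "bounded_clinear A \<Longrightarrow> A (x + y) = A x + A y"
  unfolding bounded_clinear_def by (simp add: bounded_linear.linear linear_add)

lemma bounded_clinear_diff: "bounded_clinear A \<Longrightarrow> A (x - y) = A x - A y"
  unfolding bounded_clinear_def by (simp add: bounded_linear.linear linear_diff)

lemma bounded_clinear_scaleC: "bounded_clinear A \<Longrightarrow> A (c *\<^sub>C x) = c *\<^sub>C A x"
  unfolding bounded_clinear_def by simp

lemma bounded_clinear_expand:
  assumes "bounded_clinear A" and "orthonormal_basis E"
  shows "A x = (\<Sum>e\<in>E. cinner x e *\<^sub>C A e)"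
  using clinear_sum[of A "\<lambda>e. cinner x e" "\<lambda>e. e" E] assms
  unfolding orthonormal_basis_def by (metis bounded_clinear_add bounded_clinear_scaleC)

lemma bounded_clinear_compose:
  "bounded_clinear A \<Longrightarrow> bounded_clinear B \<Longrightarrow> bounded_clinear (A \<circ> B)"
  by (rule bounded_clinearI) (simp_all add: bounded_clinear_add bounded_clinear_scaleC)

lemma cinner_cadjoint:
  assumes A: "bounded_clinear A"
  shows "cinner (A x) y = cinner x (cadjoint A y)"
proof -
  obtain E :: "'a set" where E: "orthonormal_basis E"
    using orthonormal_basis_exists by blast
  define B where "B y = (\<Sum>e\<in>E. cinner y (A e) *\<^sub>C e)" for y
  have B: "cinner (A x) y = cinner x (B y)" for x y
    by (subst bounded_clinear_expand[OF A E])
      (simp add: B_def cinner_sum_left cinner_sum_right cinner_scaleC_left cinner_scaleC_right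
        flip: cinner_commute mult.commute)
  have "cadjoint A = B"
    unfolding cadjoint_def
  proof (rule the_equality)
    show "\<forall>x y. cinner (A x) y = cinner x (B y)"
      using B by blast
    fix B' assume B': "\<forall>x y. cinner (A x) y = cinner x (B' y)"
    then have "cinner (B' y) x = cinner (B y) x" for x y
      using B by (metis cinner_commute)
    then show "B' = B"
      by (auto intro: cinner_eqI)
  qed
  then show ?thesis
    using B by simp
qed

lemma cinner_cadjoint_left:
  "bounded_clinear A \<Longrightarrow> cinner (cadjoint A x) y = cinner x (A y)"
  by (metis cinner_cadjoint cinner_commute)

lemma cadjoint_eqI:
  assumes "bounded_clinear A" and "\<And>x y. cinner (A x) y = cinner x (B y)"
  shows "cadjoint A = B"
proof
  show "cadjoint A y = B y" for y
    by (rule cinner_eqI) (metis assms cinner_cadjoint cinner_commute)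
qed

lemma bounded_clinear_cadjoint:
  assumes "bounded_clinear A"
  shows "bounded_clinear (cadjoint A)"
proof (rule bounded_clinearI)
  show "cadjoint A (x + y) = cadjoint A x + cadjoint A y" for x y
    by (rule cinner_eqI) (simp add: cinner_add_left cinner_cadjoint_left assms)
  show "cadjoint A (c *\<^sub>C x) = c *\<^sub>C cadjoint A x" for c x
    by (rule cinner_eqI) (simp add: cinner_scaleC_left cinner_cadjoint_left assms)
qed

lemma unitaryD:
  assumes "unitary U"
  shows "bounded_clinear U" and "cadjoint U (U x) = x" and "U (cadjoint U x) = x"
    and "cinner (U x) (U y) = cinner x y" and "norm (U x) = norm x"
    and "norm (cadjoint U x) = norm x"
proof -
  show U: "bounded_clinear U" and 1: "\<And>x. cadjoint U (U x) = x" and 2: "\<And>x. U (cadjoint U x) = x"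
    using assms unfolding unitary_def by (simp_all add: fun_eq_iff)
  show 3: "\<And>x y. cinner (U x) (U y) = cinner x y"
    using cinner_cadjoint[OF U] 1 by simp
  show 4: "norm (U x) = norm x" for x
    using 3[of x x] by (simp add: cinner_self flip: of_real_power)
  show "norm (cadjoint U x) = norm x"
    using 4[of "cadjoint U x"] 2 by simp
qed

lemma conjugationD:
  assumes "conjugation J"
  shows "J (x + y) = J x + J y" and "J (c *\<^sub>C x) = cnj c *\<^sub>C J x" and "J (J x) = x"
    and "cinner (J x) (J y) = cinner y x" and "cinner (J x) y = cinner (J y) x"
    and "cinner x (J y) = cinner y (J x)" and "norm (J x) = norm x"
    and "J (x - y) = J x - J y"
proof -
  show 1: "\<And>x y. J (x + y) = J x + J y" and 2: "\<And>c x. J (c *\<^sub>C x) = cnj c *\<^sub>C J x"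
    and 3: "\<And>x. J (J x) = x" and 4: "\<And>x y. cinner (J x) (J y) = cinner y x"
    using assms unfolding conjugation_def by blast+
  show "cinner (J x) y = cinner (J y) x"
    by (metis 3 4)
  show "cinner x (J y) = cinner y (J x)"
    by (metis 3 4)
  show "norm (J x) = norm x" for x
    using 4[of x x] by (simp add: cinner_self flip: of_real_power)
  show "J (x - y) = J x - J y"
    by (metis 1 add_diff_cancel diff_add_cancel)
qed

lemma bounded_linear_conjugation:
  assumes "conjugation J"
  shows "bounded_linear J"
proof (rule bounded_linear_intro[of _ 1])
  show "J (r *\<^sub>R x) = r *\<^sub>R J x" for r x
    using conjugationD(2)[OF assms, of "of_real r"] by (simp add: scaleC_of_real)
qed (simp_all add: conjugationD[OF assms])

lemma conjugation_compose_bounded_clinear: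
  "conjugation J \<Longrightarrow> bounded_clinear A \<Longrightarrow> conjugation J' \<Longrightarrow> bounded_clinear (J \<circ> A \<circ> J')"
  by (rule bounded_clinearI) (simp_all add: conjugationD bounded_clinear_add bounded_clinear_scaleC)

lemma borel_measurable_conjugation:
  assumes "conjugation J" and "f \<in> borel_measurable M"
  shows "(\<lambda>z. J (f z)) \<in> borel_measurable M"
  by (rule borel_measurable_continuous_on[OF _ assms(2)])
    (rule linear_continuous_on[OF bounded_linear_conjugation[OF assms(1)]])

section \<open>Lebesgue measure on the unit circle\<close>

lemma sets_circle_sphere: "sphere (0::complex) 1 \<in> sets borel"
  by (simp add: borel_closed)

lemma space_circle [simp]: "space circle = sphere 0 1"
  by (simp add: circle_def space_restrict_space)

lemma sets_circle [measurable_cong]: "sets circle = sets (restrict_space borel (sphere 0 1))"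
  by (simp add: circle_def)

lemma borel_measurable_circleI:
  "f \<in> borel_measurable borel \<Longrightarrow> f \<in> borel_measurable circle"
  using measurable_restrict_space1 measurable_cong_sets[OF sets_circle refl] by blast

lemma borel_measurable_circle_power [measurable]: "(\<lambda>z. z ^ n) \<in> borel_measurable circle"
  and borel_measurable_circle_ident [measurable]: "(\<lambda>z. z) \<in> borel_measurable circle"
  by (auto intro!: borel_measurable_circleI borel_measurable_continuous_onI continuous_intros)

lemma borel_measurable_cnj [measurable (raw)]:
  assumes "f \<in> borel_measurable M"
  shows "(\<lambda>x. cnj (f x)) \<in> borel_measurable M"
  by (rule borel_measurable_continuous_on[OF _ assms]) (intro continuous_intros)

lemma on_circle: "cmod z = 1 \<Longrightarrow> z * cnj z = 1" "cmod z = 1 \<Longrightarrow> cnj z * z = 1"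
  by (metis complex_norm_square of_real_1 one_power2 mult.commute)+

lemma circle_power_cancel:
  assumes "cmod z = 1"
  shows "cnj z ^ N * z ^ k = (if N \<le> k then z ^ (k - N) else cnj z ^ (N - k))"
proof (cases "N \<le> k")
  case True
  then have "cnj z ^ N * z ^ k = (cnj z * z) ^ N * z ^ (k - N)"
    by (simp add: power_mult_distrib mult.assoc flip: power_add)
  then show ?thesis
    using True assms by (simp add: on_circle)
next
  case False
  then have "cnj z ^ N * z ^ k = (cnj z * z) ^ k * cnj z ^ (N - k)"
    by (simp add: power_mult_distrib mult.assoc mult.commute flip: power_add)
  then show ?thesis
    using False assms by (simp add: on_circle)
qed

lemma AE_circleI: "(\<And>z. cmod z = 1 \<Longrightarrow> P z) \<Longrightarrow> AE z in circle. P z"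
  by (rule AE_I2) simp

lemma circle_uniform_density:
  "uniform_measure lborel {0..2 * pi} = density lborel (\<lambda>t. ennreal (indicator {0..2 * pi} t / (2 * pi)))"
  unfolding uniform_measure_def
  by (intro arg_cong2[where f=density] refl ext)
    (auto simp: indicator_def divide_ennreal ennreal_1[symmetric] simp del: ennreal_1)

lemma cis_measurable:
  "cis \<in> measurable (uniform_measure lborel {0..2 * pi}) (restrict_space borel (sphere 0 1))"
proof (rule measurable_restrict_space2)
  have "cis \<in> borel_measurable borel"
    by (intro borel_measurable_continuous_onI continuous_intros)
  then show "cis \<in> borel_measurable (uniform_measure lborel {0..2 * pi})"
    using measurable_cong_sets[of "uniform_measure lborel {0..2 * pi}" borel borel borel] by simp
qed auto

lemma emeasure_circle: "emeasure circle (sphere 0 1) = 1"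
proof -
  have "emeasure circle (sphere 0 1)
      = emeasure (uniform_measure lborel {0..2 * pi}) (cis -` sphere 0 1 \<inter> UNIV)"
    unfolding circle_def
    by (subst emeasure_distr)
      (auto simp: sets_restrict_space_iff sets_circle_sphere intro: cis_measurable)
  also have "cis -` sphere 0 1 \<inter> UNIV = UNIV"
    by auto
  also have "emeasure (uniform_measure lborel {0..2 * pi}) UNIV = 1"
    by (simp add: divide_ennreal ennreal_1[symmetric] del: ennreal_1)
  finally show ?thesis .
qed

interpretation circle: finite_measure circle
  by standard (simp add: emeasure_circle)

lemma measure_circle: "measure circle (sphere 0 1) = 1"
  by (simp add: measure_def emeasure_circle)

lemma integral_circle:
  fixes f :: "complex \<Rightarrow> complex"
  assumes f [measurable]: "f \<in> borel_measurable circle"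
  shows "(LINT z|circle. f z)
    = (LINT t|lborel. indicator {0..2 * pi} t *\<^sub>R f (cis t)) / of_real (2 * pi)"
proof -
  have f': "f \<in> borel_measurable (restrict_space borel (sphere 0 1))"
    using f measurable_cong_sets[OF sets_circle refl] by blast
  have m: "(\<lambda>t. f (cis t)) \<in> borel_measurable lborel"
    using measurable_compose[OF cis_measurable f'] by simp
  have "(LINT z|circle. f z) = (LINT t|uniform_measure lborel {0..2 * pi}. f (cis t))"
    unfolding circle_def by (rule integral_distr[OF cis_measurable f'])
  also have "\<dots> = (LINT t|lborel. (indicator {0..2 * pi} t / (2 * pi)) *\<^sub>R f (cis t))"
    unfolding circle_uniform_density by (rule integral_density[OF m]) auto
  also have "\<dots> = (LINT t|lborel. (indicator {0..2 * pi} t *\<^sub>R f (cis t)) / of_real (2 * pi))"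
    by (intro Bochner_Integration.integral_cong refl) (simp add: scaleR_conv_of_real)
  finally show ?thesis
    by simp
qed

lemma integral_circle_power:
  assumes "m > 0"
  shows "(LINT z|circle. z ^ m) = 0"
proof -
  have *: "(LINT t|lborel. indicator {0..2 * pi} t *\<^sub>R cis (real m * t))
      = cis (real m * (2 * pi)) / (\<i> * of_nat m) - cis (real m * 0) / (\<i> * of_nat m)"
  proof (rule integral_FTC_atLeastAtMost)
    fix t :: real
    have "((\<lambda>t. cis (real m * t)) has_vector_derivative (real m *\<^sub>R (\<i> * cis (real m * t)))) (at t)"
      unfolding has_vector_derivative_def
      by (rule has_derivative_eq_rhs, rule has_derivative_cis)
        (auto intro!: derivative_eq_intros simp: mult.commute)
    then have "((\<lambda>t. cis (real m * t) / (\<i> * of_nat m)) has_vector_derivative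
        (real m *\<^sub>R (\<i> * cis (real m * t))) / (\<i> * of_nat m)) (at t)"
      by (rule has_vector_derivative_divide)
    then show "((\<lambda>t. cis (real m * t) / (\<i> * of_nat m)) has_vector_derivative cis (real m * t))
        (at t within {0..2 * pi})"
      using assms by (simp add: scaleR_conv_of_real has_vector_derivative_at_within)
  qed (auto intro!: continuous_intros)
  have "cis (real m * (2 * pi)) = 1"
    by (metis Complex.DeMoivre cis_2pi power_one)
  with * show ?thesis
    by (subst integral_circle) (simp_all add: Complex.DeMoivre)
qed

section \<open>Trigonometric polynomials\<close>

text \<open>On the circle \<open>cnj z = 1 / z\<close>, so trigonometric polynomials are the functions
  \<open>cnj z ^ N * poly p z\<close>; in this form closure under products is plain.\<close>

definition trig_poly :: "(complex \<Rightarrow> complex) \<Rightarrow> bool"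
  where "trig_poly f \<longleftrightarrow> (\<exists>N p. \<forall>z\<in>sphere 0 1. f z = cnj z ^ N * poly p z)"

lemma trig_poly_add:
  assumes "trig_poly f" and "trig_poly g"
  shows "trig_poly (\<lambda>z. f z + g z)"
proof -
  obtain N p M q where f: "\<And>z. z \<in> sphere 0 1 \<Longrightarrow> f z = cnj z ^ N * poly p z"
    and g: "\<And>z. z \<in> sphere 0 1 \<Longrightarrow> g z = cnj z ^ M * poly q z"
    using assms unfolding trig_poly_def by blast
  have "f z + g z = cnj z ^ (N + M) * poly (monom 1 M * p + monom 1 N * q) z"
    if z: "z \<in> sphere 0 1" for z
  proof -
    have "cnj z ^ (N + M) * poly (monom 1 M * p + monom 1 N * q) z
        = cnj z ^ N * (cnj z * z) ^ M * poly p z + cnj z ^ M * (cnj z * z) ^ N * poly q z"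
      by (simp add: poly_monom power_add power_mult_distrib algebra_simps)
    then show ?thesis
      using z by (simp add: f g on_circle)
  qed
  then show ?thesis
    unfolding trig_poly_def by blast
qed

lemma trig_poly_mult:
  assumes "trig_poly f" and "trig_poly g"
  shows "trig_poly (\<lambda>z. f z * g z)"
proof -
  obtain N p M q where "\<And>z. z \<in> sphere 0 1 \<Longrightarrow> f z = cnj z ^ N * poly p z"
    and "\<And>z. z \<in> sphere 0 1 \<Longrightarrow> g z = cnj z ^ M * poly q z"
    using assms unfolding trig_poly_def by blast
  then have "\<forall>z\<in>sphere 0 1. f z * g z = cnj z ^ (N + M) * poly (p * q) z"
    by (simp add: power_add)
  then show ?thesis
    unfolding trig_poly_def by blast
qed

lemma trig_poly_const: "trig_poly (\<lambda>z. c)"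
  unfolding trig_poly_def by (intro exI[of _ 0] exI[of _ "[:c:]"]) simp

lemma trig_poly_ident: "trig_poly (\<lambda>z. z)"
  unfolding trig_poly_def by (intro exI[of _ 0] exI[of _ "[:0, 1:]"]) simp

lemma trig_poly_cnj: "trig_poly cnj"
  unfolding trig_poly_def by (intro exI[of _ 1] exI[of _ "[:1:]"]) simp

lemma real_polynomial_trig_poly:
  fixes f :: "complex \<Rightarrow> real"
  assumes "real_polynomial_function f"
  shows "trig_poly (\<lambda>z. of_real (f z))"
  using assms
proof (induction f)
  case (linear f)
  define a b where "a = (of_real (f 1) - \<i> * of_real (f \<i>)) / 2"
    and "b = (of_real (f 1) + \<i> * of_real (f \<i>)) / 2"
  have eq: "complex_of_real (f z) = a * z + b * cnj z" for z
  proof -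
    have "f z = f (Re z *\<^sub>R 1 + Im z *\<^sub>R \<i>)"
      by (rule arg_cong[of _ _ f]) (simp add: complex_eq_iff)
    also have "\<dots> = Re z * f 1 + Im z * f \<i>"
      using linear by (simp add: linear_add linear_scale bounded_linear.linear)
    finally show ?thesis
      by (simp add: a_def b_def complex_eq_iff field_simps)
  qed
  show ?case
    unfolding eq by (intro trig_poly_add trig_poly_mult trig_poly_const trig_poly_ident trig_poly_cnj)
next
  case (const c)
  then show ?case
    by (rule trig_poly_const)
qed (simp_all add: trig_poly_add trig_poly_mult)

lemma polynomial_function_trig_poly:
  fixes f :: "complex \<Rightarrow> complex"
  assumes "polynomial_function f"
  shows "trig_poly f"
proof -
  have "real_polynomial_function (\<lambda>z. Re (f z))" "real_polynomial_function (\<lambda>z. Im (f z))"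
    using assms bounded_linear_Re bounded_linear_Im unfolding polynomial_function_def o_def by blast+
  then have "trig_poly (\<lambda>z. of_real (Re (f z)) + \<i> * of_real (Im (f z)))"
    by (intro trig_poly_add trig_poly_mult trig_poly_const real_polynomial_trig_poly)
  then show ?thesis
    by (simp add: complex_eq[symmetric])
qed

text \<open>A functional monotone class theorem.  Uniform limits of trigonometric polynomials give all
  continuous functions (Stone--Weierstrass), bounded pointwise limits of these give the indicators
  of closed sets, Dynkin's argument gives those of all Borel sets, and simple functions do the
  rest.  Both the uniqueness of Fourier coefficients and the density of trigonometric polynomials
  are instances.\<close>

lemma bounded_measurable_circle_induct [consumes 2, case_names power cnj_power add scale limit]:
  fixes P :: "(complex \<Rightarrow> complex) \<Rightarrow> bool"
  assumes f_meas: "f \<in> borel_measurable circle"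
    and f_bound: "\<forall>z\<in>sphere 0 1. cmod (f z) \<le> B"
    and power: "\<And>n. P (\<lambda>z. z ^ n)"
    and cnj_power: "\<And>n. P (\<lambda>z. cnj z ^ n)"
    and add: "\<And>f g. P f \<Longrightarrow> P g \<Longrightarrow> P (\<lambda>z. f z + g z)"
    and scale: "\<And>c f. P f \<Longrightarrow> P (\<lambda>z. c * f z)"
    and limit: "\<And>s f B. (\<And>n. s n \<in> borel_measurable circle) \<Longrightarrow>
      (\<And>n z. cmod z = 1 \<Longrightarrow> cmod (s n z) \<le> B) \<Longrightarrow>
      (\<And>z. cmod z = 1 \<Longrightarrow> (\<lambda>n. s n z) \<longlonglongrightarrow> f z) \<Longrightarrow> (\<And>n. P (s n)) \<Longrightarrow> P f"
  shows "P f"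
proof -
  have zero: "P (\<lambda>z. 0)"
    using scale[OF power, of 0] by simp
  have sum: "P (\<lambda>z. \<Sum>i\<in>I. g i z)" if "finite I" "\<And>i. i \<in> I \<Longrightarrow> P (g i)" for I :: "'i set" and g
    using that by (induction I) (simp_all add: zero add)
  have cong: "P g" if "P f" "\<And>z. cmod z = 1 \<Longrightarrow> f z = g z" "f \<in> borel_measurable circle"
    "\<And>z. cmod z = 1 \<Longrightarrow> cmod (f z) \<le> B" for f g B
    by (rule limit[of "\<lambda>_. f" B]) (use that in auto)
  have trig: "P g" if g_trig: "trig_poly g" for g
  proof -
    obtain N p where "\<forall>z\<in>sphere 0 1. g z = cnj z ^ N * poly p z"
      using g_trig unfolding trig_poly_def by blast
    then have g: "\<And>z. cmod z = 1 \<Longrightarrow> g z = cnj z ^ N * poly p z"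
      by simp
    define h where "h k z = (if N \<le> k then z ^ (k - N) else cnj z ^ (N - k))" for k and z :: complex
    have "P (h k)" for k
      using power[of "k - N"] cnj_power[of "N - k"] by (cases "N \<le> k") (simp_all add: h_def[abs_def])
    then have "P (\<lambda>z. \<Sum>k\<le>degree p. coeff p k * h k z)"
      by (intro sum scale) auto
    moreover have "(\<Sum>k\<le>degree p. coeff p k * h k z) = g z" if "cmod z = 1" for z
      unfolding g[OF that] poly_altdef sum_distrib_left h_def
      by (intro sum.cong refl) (simp add: circle_power_cancel[OF that] mult.left_commute)
    moreover have "(\<lambda>z. \<Sum>k\<le>degree p. coeff p k * h k z) \<in> borel_measurable circle"
      unfolding h_def by measurable
    moreover have "cmod (\<Sum>k\<le>degree p. coeff p k * h k z) \<le> (\<Sum>k\<le>degree p. cmod (coeff p k))"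
      if "cmod z = 1" for z
      by (rule sum_norm_le) (simp add: h_def norm_mult norm_power that)
    ultimately show ?thesis
      by (rule cong)
  qed
  have trig_meas: "g \<in> borel_measurable circle" if "polynomial_function g" for g :: "complex \<Rightarrow> complex"
    using that by (intro borel_measurable_circleI borel_measurable_continuous_onI)
      (simp add: continuous_on_polymonial_function)
  have cont: "P g" if g: "continuous_on UNIV g" for g
  proof -
    have g': "continuous_on (sphere 0 1) g"
      using g continuous_on_subset by blast
    have "\<exists>q. polynomial_function q \<and> (\<forall>z\<in>sphere 0 1. cmod (g z - q z) < 1 / Suc n)" for n
      by (rule Stone_Weierstrass_polynomial_function[OF _ g']) auto
    then obtain s where s: "\<And>n. polynomial_function (s n)"
      "\<And>n z. cmod z = 1 \<Longrightarrow> cmod (g z - s n z) < 1 / Suc n"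
      by (metis mem_sphere_0)
    obtain B where "\<forall>z\<in>sphere 0 1. cmod (g z) \<le> B"
      using compact_imp_bounded[OF compact_continuous_image[OF g' compact_sphere]]
      unfolding bounded_iff by blast
    then have B: "\<And>z. cmod z = 1 \<Longrightarrow> cmod (g z) \<le> B"
      by simp
    show ?thesis
    proof (rule limit[of s "B + 1"])
      fix n and z :: complex assume z: "cmod z = 1"
      have "cmod (s n z) \<le> cmod (g z) + cmod (g z - s n z)"
        by (metis norm_minus_commute norm_triangle_sub)
      also have "\<dots> \<le> B + 1"
      proof -
        have "1 / real (Suc n) \<le> 1"
          by simp
        with B[OF z] s(2)[OF z, of n] show ?thesis
          by linarith
      qed
      finally show "cmod (s n z) \<le> B + 1" .
    next
      fix z :: complex assume z: "cmod z = 1"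
      have "(\<lambda>n. s n z - g z) \<longlonglongrightarrow> 0"
      proof (rule Lim_null_comparison)
        show "\<forall>\<^sub>F n in sequentially. cmod (s n z - g z) \<le> 1 / Suc n"
          using s(2)[OF z] by (intro always_eventually allI less_imp_le) (simp add: norm_minus_commute)
        show "(\<lambda>n. 1 / real (Suc n)) \<longlonglongrightarrow> 0"
          by (rule LIMSEQ_Suc[OF lim_1_over_n])
      qed
      then show "(\<lambda>n. s n z) \<longlonglongrightarrow> g z"
        by (rule LIM_zero_cancel)
    next
      show "s n \<in> borel_measurable circle" and "P (s n)" for n
        by (intro trig_meas trig polynomial_function_trig_poly s(1))+
    qed
  qed
  have closed: "P (indicator K)" if K: "closed K" for K :: "complex set"
  proof (cases "K = {}")
    case False
    define s where "s n z = complex_of_real (max 0 (1 - real n * infdist z K))" for n z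
    have s_cont: "continuous_on UNIV (s n)" for n
      unfolding s_def by (intro continuous_intros)
    have "s n \<in> borel_measurable circle" for n
      by (intro borel_measurable_circleI borel_measurable_continuous_onI s_cont)
    moreover have "P (s n)" for n
      by (intro cont s_cont)
    moreover have "(\<lambda>n. s n z) \<longlonglongrightarrow> indicator K z" for z
    proof (cases "z \<in> K")
      case True
      then show ?thesis
        by (simp add: s_def)
    next
      case nK: False
      then have pos: "infdist z K > 0"
        using K False by (simp add: infdist_pos_not_in_closed)
      obtain n0 where n0: "real n0 * infdist z K > 1"
        using pos reals_Archimedean3 by blast
      have "\<forall>\<^sub>F n in sequentially. s n z = indicator K z"
        unfolding eventually_sequentially
      proof (intro exI[of _ n0] allI impI)
        fix n assume "n0 \<le> n"
        then have "real n * infdist z K > 1"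
          using n0 pos by (smt (verit) mult_right_mono of_nat_le_iff)
        then show "s n z = indicator K z"
          using nK by (simp add: s_def)
      qed
      then show ?thesis
        by (rule tendsto_eventually)
    qed
    moreover have "cmod (s n z) \<le> 1" for n z
      unfolding s_def by (simp add: infdist_nonneg)
    ultimately show ?thesis
      by - (rule limit[of s 1])
  qed (simp add: zero indicator_def[abs_def])
  have borel: "P (indicator A)" if "A \<in> sets borel" for A :: "complex set"
  proof -
    have "Int_stable (Collect closed :: complex set set)"
      by (auto simp: Int_stable_def)
    moreover have "Collect closed \<subseteq> Pow (UNIV :: complex set)"
      by simp
    moreover have "A \<in> sigma_sets UNIV (Collect closed)"
      using that by (simp add: borel_eq_closed)
    ultimately show ?thesis
    proof (induction rule: sigma_sets_induct_disjoint)
      case (basic A)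
      then show ?case
        by (simp add: closed)
    next
      case empty
      show ?case
        by (simp add: zero indicator_def[abs_def])
    next
      case (compl A)
      have "P (\<lambda>z. 1 + (-1) * indicator A z)"
        by (intro add scale compl) (use power[of 0] in simp)
      then show ?case
        by (rule back_subst[of P]) (auto simp: indicator_def fun_eq_iff)
    next
      case (union A)
      have A: "A i \<in> sets borel" for i
        using union(2) unfolding borel_eq_closed by auto
      have eq: "(\<Sum>i<n. indicator (A i) z) = (indicator (\<Union>i<n. A i) z :: complex)" for n z
        using union(1) by (intro indicator_UN_disjoint[symmetric]) (auto simp: disjoint_family_on_def)
      show ?case
      proof (rule limit[of "\<lambda>n z. \<Sum>i<n. indicator (A i) z" 1])
        show "(\<lambda>z. \<Sum>i<n. indicator (A i) z :: complex) \<in> borel_measurable circle" for n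
          by (intro borel_measurable_circleI borel_measurable_sum borel_measurable_indicator A)
        show "cmod (\<Sum>i<n. indicator (A i) z) \<le> 1" for n z
          unfolding eq by (simp add: indicator_def)
        show "P (\<lambda>z. \<Sum>i<n. indicator (A i) z)" for n
          by (intro sum union) auto
        fix z :: complex
        show "(\<lambda>n. \<Sum>i<n. indicator (A i) z :: complex) \<longlonglongrightarrow> indicator (\<Union>i. A i) z"
          unfolding eq by (rule LIMSEQ_indicator_UN)
      qed
    qed
  qed
  obtain s where "\<forall>i. simple_function circle (s i)"
    and "\<forall>z\<in>space circle. (\<lambda>i. s i z) \<longlonglongrightarrow> f z"
    and "\<forall>i. \<forall>z\<in>space circle. dist (s i z) 0 \<le> 2 * dist (f z) 0"
    using borel_measurable_implies_sequence_metric[OF f_meas, of 0] by blast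
  then have s: "simple_function circle (s i)"
    "cmod z = 1 \<Longrightarrow> (\<lambda>i. s i z) \<longlonglongrightarrow> f z"
    "cmod z = 1 \<Longrightarrow> cmod (s i z) \<le> 2 * cmod (f z)" for i z
    by simp_all
  have s_meas: "s i \<in> borel_measurable circle" for i
    using s(1) by (rule borel_measurable_simple_function)
  have s_bound: "cmod (s i z) \<le> 2 * B" if "cmod z = 1" for i z
    using s(3)[OF that, of i] bspec[OF f_bound, of z] that by simp
  show "P f"
  proof (rule limit[OF s_meas s_bound s(2)])
    fix i
    define V where "V = s i ` sphere 0 1"
    have A: "s i -` {v} \<inter> sphere 0 1 \<in> sets borel" if "v \<in> V" for v
      using s(1)[of i] that unfolding simple_function_def V_def
      by (auto simp: sets_circle sets_restrict_space_iff sets_circle_sphere)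
    have "finite V"
      using s(1)[of i] unfolding simple_function_def V_def by simp
    have eq: "(\<Sum>v\<in>V. v * indicator (s i -` {v} \<inter> sphere 0 1) z) = s i z" if "cmod z = 1" for z
    proof -
      have "(\<Sum>v\<in>V. v * indicator (s i -` {v} \<inter> sphere 0 1) z) = (\<Sum>v\<in>V. if v = s i z then s i z else 0)"
        using that by (intro sum.cong refl) (auto simp: indicator_def)
      also have "\<dots> = s i z"
        using that \<open>finite V\<close> by (simp add: V_def)
      finally show ?thesis .
    qed
    have m: "(\<lambda>z. \<Sum>v\<in>V. v * indicator (s i -` {v} \<inter> sphere 0 1) z) \<in> borel_measurable circle"
      by (subst measurable_cong[of _ _ "s i"]) (simp_all add: eq s_meas)
    have b: "cmod (\<Sum>v\<in>V. v * indicator (s i -` {v} \<inter> sphere 0 1) z) \<le> 2 * B" if "cmod z = 1" for z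
      unfolding eq[OF that] by (rule s_bound[OF that])
    have "P (\<lambda>z. \<Sum>v\<in>V. v * indicator (s i -` {v} \<inter> sphere 0 1) z)"
      using \<open>finite V\<close> A by (intro sum scale borel) auto
    then show "P (s i)"
      by (rule cong[OF _ eq m b])
  qed
qed

section \<open>Square-integrable functions on the circle\<close>

lemma integrable_circle_bound:
  fixes f :: "complex \<Rightarrow> 'a::{banach, second_countable_topology}" and g :: "complex \<Rightarrow> real"
  assumes "integrable circle g" and "f \<in> borel_measurable circle"
    and "AE z in circle. norm (f z) \<le> g z"
  shows "integrable circle f"
proof (rule Bochner_Integration.integrable_bound[OF assms(1,2)])
  show "AE z in circle. norm (f z) \<le> norm (g z)"
    using assms(3) by eventually_elim simp
qed

lemma L2_measurable: "f \<in> L2 \<Longrightarrow> f \<in> borel_measurable circle"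
  by (simp add: L2_def)

lemma L2_integrable_square: "f \<in> L2 \<Longrightarrow> integrable circle (\<lambda>z. (norm (f z))\<^sup>2)"
  by (simp add: L2_def)

lemma L2_bound:
  assumes "g \<in> L2" and "f \<in> borel_measurable circle" and "AE z in circle. norm (f z) \<le> M * norm (g z)"
  shows "f \<in> L2"
proof -
  have "integrable circle (\<lambda>z. (norm (f z))\<^sup>2)"
  proof (rule integrable_circle_bound)
    show "integrable circle (\<lambda>z. M\<^sup>2 * (norm (g z))\<^sup>2)"
      using L2_integrable_square[OF assms(1)] by simp
    show "AE z in circle. norm ((norm (f z))\<^sup>2) \<le> M\<^sup>2 * (norm (g z))\<^sup>2"
      using assms(3) by eventually_elim (metis norm_ge_zero norm_power power_mono power_mult_distrib real_norm_def abs_norm_cancel)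
  qed (use assms in measurable)
  then show ?thesis
    using assms by (simp add: L2_def)
qed

lemma L2_bounded:
  assumes "f \<in> borel_measurable circle" and "AE z in circle. norm (f z) \<le> B"
  shows "f \<in> L2"
proof -
  have "(\<lambda>z. 1::complex) \<in> L2"
    by (simp add: L2_def)
  then show ?thesis
    by (rule L2_bound[of _ _ B]) (use assms in simp_all)
qed

lemma L2_cong_AE:
  assumes "f \<in> L2" and "g \<in> borel_measurable circle" and "AE z in circle. f z = g z"
  shows "g \<in> L2"
  by (rule L2_bound[OF assms(1,2), of 1]) (use assms(3) in eventually_elim, simp)

lemma norm_add_square_le: "(norm (a + b))\<^sup>2 \<le> 2 * (norm a)\<^sup>2 + 2 * (norm (b::'a::real_normed_vector))\<^sup>2"
proof -
  have "(norm (a + b))\<^sup>2 \<le> (norm a + norm b)\<^sup>2"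
    by (intro power_mono norm_triangle_ineq) simp
  also have "\<dots> \<le> 2 * (norm a)\<^sup>2 + 2 * (norm b)\<^sup>2"
    using zero_le_power2[of "norm a - norm b"] by (simp add: power2_eq_square algebra_simps)
  finally show ?thesis .
qed

lemma L2_add:
  assumes "f \<in> L2" and "g \<in> L2"
  shows "(\<lambda>z. f z + g z) \<in> L2"
proof -
  note [measurable] = assms[THEN L2_measurable]
  have "integrable circle (\<lambda>z. (norm (f z + g z))\<^sup>2)"
  proof (rule integrable_circle_bound)
    show "integrable circle (\<lambda>z. 2 * (norm (f z))\<^sup>2 + 2 * (norm (g z))\<^sup>2)"
      using assms by (simp add: L2_integrable_square)
  qed (simp_all add: norm_add_square_le)
  then show ?thesis
    by (simp add: L2_def)
qed

lemma L2_square_integral_add: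
  assumes "f \<in> L2" and "g \<in> L2"
  shows "(LINT z|circle. (norm (f z + g z))\<^sup>2)
    \<le> 2 * (LINT z|circle. (norm (f z))\<^sup>2) + 2 * (LINT z|circle. (norm (g z))\<^sup>2)"
proof -
  have "(LINT z|circle. (norm (f z + g z))\<^sup>2)
      \<le> (LINT z|circle. 2 * (norm (f z))\<^sup>2 + 2 * (norm (g z))\<^sup>2)"
    by (intro integral_mono norm_add_square_le) (use assms in \<open>simp_all add: L2_integrable_square L2_add\<close>)
  then show ?thesis
    using assms by (simp add: L2_integrable_square)
qed

lemma L2_scaleC_bounded:
  assumes "f \<in> L2" and "a \<in> borel_measurable circle" and "\<And>z. cmod z = 1 \<Longrightarrow> cmod (a z) \<le> B"
  shows "(\<lambda>z. a z *\<^sub>C f z) \<in> L2"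
proof (rule L2_bound[OF assms(1), of _ B])
  note [measurable] = assms(2) L2_measurable[OF assms(1)]
  show "(\<lambda>z. a z *\<^sub>C f z) \<in> borel_measurable circle"
    by measurable
qed (auto intro!: AE_circleI mult_right_mono assms)

lemma L2_scaleC: "f \<in> L2 \<Longrightarrow> (\<lambda>z. c *\<^sub>C f z) \<in> L2"
  by (rule L2_scaleC_bounded[of _ _ "cmod c"]) auto

lemma L2_power: "f \<in> L2 \<Longrightarrow> (\<lambda>z. z ^ n *\<^sub>C f z) \<in> L2"
  by (rule L2_scaleC_bounded[of _ _ 1]) (auto simp: norm_power)

lemma L2_cnj_mult: "f \<in> L2 \<Longrightarrow> (\<lambda>z. cnj z *\<^sub>C f z) \<in> L2"
  by (rule L2_scaleC_bounded[of _ _ 1]) auto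

lemma L2_diff:
  assumes "f \<in> L2" and "g \<in> L2"
  shows "(\<lambda>z. f z - g z) \<in> L2"
  using L2_add[OF assms(1) L2_scaleC[OF assms(2), of "-1"]] by (simp add: scaleC_minus_one)

lemma L2_const: "(\<lambda>z. x) \<in> L2"
  by (rule L2_bounded[of _ "norm x"]) auto

lemma integrable_cinner:
  assumes "f \<in> L2" and "g \<in> L2"
  shows "integrable circle (\<lambda>z. cinner (f z) (g z))"
proof (rule integrable_circle_bound)
  note [measurable] = assms[THEN L2_measurable]
  show "(\<lambda>z. cinner (f z) (g z)) \<in> borel_measurable circle"
    by measurable
  show "integrable circle (\<lambda>z. (norm (f z))\<^sup>2 + (norm (g z))\<^sup>2)"
    using assms by (simp add: L2_integrable_square)
  have "cmod (cinner x y) \<le> (norm x)\<^sup>2 + (norm y)\<^sup>2" for x y :: 'a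
  proof -
    have "norm x * norm y \<le> (norm x)\<^sup>2 + (norm y)\<^sup>2"
      using zero_le_power2[of "norm x - norm y"] zero_le_power2[of "norm x"] zero_le_power2[of "norm y"]
      unfolding power2_diff by linarith
    then show ?thesis
      using cinner_Cauchy_Schwarz[of x y] by linarith
  qed
  then show "AE z in circle. cmod (cinner (f z) (g z)) \<le> (norm (f z))\<^sup>2 + (norm (g z))\<^sup>2"
    by simp
qed

lemma L2_integrable:
  assumes "f \<in> L2"
  shows "integrable circle f"
proof (rule integrable_circle_bound)
  show "integrable circle (\<lambda>z. 1 + (norm (f z))\<^sup>2)"
    using assms by (simp add: L2_integrable_square)
  have "norm (f z) \<le> 1 + (norm (f z))\<^sup>2" for z
    using zero_le_power2[of "norm (f z) - 1"] zero_le_power2[of "norm (f z)"]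
    unfolding power2_diff by (simp add: add.commute) (smt (verit) norm_ge_zero)
  then show "AE z in circle. norm (f z) \<le> 1 + (norm (f z))\<^sup>2"
    by simp
qed (use assms in \<open>simp add: L2_measurable\<close>)

lemma L2_cnj: "(f :: complex \<Rightarrow> complex) \<in> L2 \<Longrightarrow> (\<lambda>z. cnj (f z)) \<in> L2"
  by (rule L2_bound[of f _ 1]) (auto intro!: borel_measurable_cnj simp: L2_measurable)

lemma integrable_mult:
  fixes f g :: "complex \<Rightarrow> complex"
  assumes "f \<in> L2" and "g \<in> L2"
  shows "integrable circle (\<lambda>z. f z * g z)"
  using integrable_cinner[OF assms(1) L2_cnj[OF assms(2)]] by (simp add: cinner_complex_def)

lemma L2_poly: "(\<lambda>z. poly p z) \<in> L2"
proof -
  have c: "continuous_on UNIV (poly p)"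
    by (intro continuous_intros)
  have "bounded (poly p ` sphere 0 1)"
    by (intro compact_imp_bounded compact_continuous_image continuous_on_subset[OF c]) auto
  then obtain B where "\<forall>z\<in>sphere 0 1. cmod (poly p z) \<le> B"
    unfolding bounded_iff by blast
  then show ?thesis
    using c by (intro L2_bounded[of _ B] borel_measurable_circleI borel_measurable_continuous_onI AE_circleI)
      auto
qed

section \<open>Uniqueness of Fourier coefficients and density of trigonometric polynomials\<close>

text \<open>Vanishing of \<open>\<integral> f g\<close> extends from powers to all bounded measurable \<open>f\<close>, in particular to the
  conjugate sign of \<open>g\<close>, for which the integral is that of \<open>|g|\<close>.\<close>

lemma AE_zero_if_moments_zero:
  fixes g :: "complex \<Rightarrow> complex"
  assumes g: "integrable circle g"
    and "\<And>n. (LINT z|circle. z ^ n * g z) = 0" and "\<And>n. (LINT z|circle. cnj z ^ n * g z) = 0"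
  shows "AE z in circle. g z = 0"
proof -
  note [measurable] = borel_measurable_integrable[OF g]
  have bound: "integrable circle (\<lambda>z. f z * g z)"
    if "f \<in> borel_measurable circle" "\<And>z. cmod z = 1 \<Longrightarrow> cmod (f z) \<le> B" for f B
  proof (rule integrable_circle_bound)
    note [measurable] = that(1)
    show "(\<lambda>z. f z * g z) \<in> borel_measurable circle"
      by measurable
    show "integrable circle (\<lambda>z. B * cmod (g z))"
      using g by simp
  qed (auto intro!: AE_circleI mult_right_mono that simp: norm_mult)
  have "(\<lambda>z. cnj (sgn (g z))) \<in> borel_measurable circle"
    unfolding sgn_eq by measurable
  moreover have "\<forall>z\<in>sphere 0 1. cmod (cnj (sgn (g z))) \<le> 1"
    by (simp add: norm_sgn)
  ultimately have "integrable circle (\<lambda>z. cnj (sgn (g z)) * g z) \<and> (LINT z|circle. cnj (sgn (g z)) * g z) = 0"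
  proof (induction rule: bounded_measurable_circle_induct)
    case (limit s f B)
    have f: "f \<in> borel_measurable circle"
      by (rule borel_measurable_LIMSEQ_metric[where f=s and g=f, OF limit(1)]) (simp add: limit)
    have fB: "cmod (f z) \<le> B" if "cmod z = 1" for z
      by (rule LIMSEQ_le_const2[OF tendsto_norm[OF limit(3)[OF that]]]) (auto intro: limit(2)[OF that])
    note [measurable] = f limit(1)
    have "(\<lambda>n. LINT z|circle. s n z * g z) \<longlonglongrightarrow> (LINT z|circle. f z * g z)"
    proof (rule integral_dominated_convergence[where w="\<lambda>z. B * cmod (g z)"])
      show "AE z in circle. (\<lambda>n. s n z * g z) \<longlonglongrightarrow> f z * g z"
        by (intro AE_circleI tendsto_mult_right limit(3))
      show "AE z in circle. norm (s n z * g z) \<le> B * cmod (g z)" for n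
        unfolding norm_mult by (intro AE_circleI mult_right_mono limit(2)) simp_all
    qed (use g in simp_all)
    moreover have "(LINT z|circle. s n z * g z) = 0" for n
      using limit(4)[of n] by simp
    ultimately have "(LINT z|circle. f z * g z) = 0"
      by (simp add: LIMSEQ_const_iff)
    then show ?case
      using bound[OF f fB] by simp
  next
    case (power n)
    show ?case
      using assms(2)[of n] by (simp add: bound[of _ 1] norm_power)
  next
    case (cnj_power n)
    show ?case
      using assms(3)[of n] by (simp add: bound[of _ 1] norm_power)
  qed (simp_all add: distrib_right mult.assoc)
  moreover have "cnj (sgn (g z)) * g z = complex_of_real (cmod (g z))" for z
    using complex_norm_square[of "g z"] by (cases "g z = 0") (simp_all add: sgn_eq power2_eq_square field_simps)
  ultimately have "(LINT z|circle. cmod (g z)) = 0"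
    by simp
  then show ?thesis
    using integral_nonneg_eq_0_iff_AE[of circle "\<lambda>z. cmod (g z)"] g by simp
qed

text \<open>The approximating trigonometric polynomial is written as \<open>p(z) + cnj (z q(z))\<close> to keep its
  non-negative and its negative frequencies apart.\<close>

lemma L2_approx_bounded:
  fixes h :: "complex \<Rightarrow> complex"
  assumes "h \<in> borel_measurable circle" and "\<forall>z\<in>sphere 0 1. cmod (h z) \<le> B" and "\<epsilon> > 0"
  shows "\<exists>p q. (LINT z|circle. (cmod (h z - (poly p z + cnj (z * poly q z))))\<^sup>2) < \<epsilon>"
proof -
  have trig: "(\<lambda>z. poly p z + cnj (z * poly q z)) \<in> L2" for p q
    using L2_poly[of "[:0, 1:] * q"] by (intro L2_add L2_poly L2_cnj) simp
  have exact: "f \<in> L2 \<and> (\<forall>\<epsilon>>0. \<exists>p q. (LINT z|circle. (cmod (f z - (poly p z + cnj (z * poly q z))))\<^sup>2) < \<epsilon>)"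
    if "\<And>z. f z = poly p z + cnj (z * poly q z)" for f p q
  proof -
    have f: "f = (\<lambda>z. poly p z + cnj (z * poly q z))"
      using that by blast
    have "(LINT z|circle. (cmod (f z - (poly p z + cnj (z * poly q z))))\<^sup>2) = 0"
      unfolding f by simp
    then show ?thesis
      using trig[of p q] unfolding f[symmetric] by metis
  qed
  have "h \<in> L2 \<and> (\<forall>\<epsilon>>0. \<exists>p q. (LINT z|circle. (cmod (h z - (poly p z + cnj (z * poly q z))))\<^sup>2) < \<epsilon>)"
    using assms(1,2)
  proof (induction rule: bounded_measurable_circle_induct)
    case (power n)
    show ?case
      by (rule exact[of _ "monom 1 n" 0]) (simp add: poly_monom)
  next
    case (cnj_power n)
    show ?case
    proof (cases n)
      case 0
      then show ?thesis
        by (intro exact[of _ 1 0]) simp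
    next
      case (Suc m)
      then show ?thesis
        by (intro exact[of _ 0 "monom 1 m"]) (simp add: poly_monom)
    qed
  next
    case (add f g)
    have "\<exists>p q. (LINT z|circle. (cmod (f z + g z - (poly p z + cnj (z * poly q z))))\<^sup>2) < \<epsilon>"
      if "\<epsilon> > 0" for \<epsilon>
    proof -
      have "\<epsilon> / 4 > 0"
        using that by simp
      then obtain p q p' q' where
        *: "(LINT z|circle. (cmod (f z - (poly p z + cnj (z * poly q z))))\<^sup>2) < \<epsilon> / 4"
          "(LINT z|circle. (cmod (g z - (poly p' z + cnj (z * poly q' z))))\<^sup>2) < \<epsilon> / 4"
        using add by meson
      have "(LINT z|circle. (cmod (f z + g z - (poly (p + p') z + cnj (z * poly (q + q') z))))\<^sup>2)
        = (LINT z|circle. (cmod ((f z - (poly p z + cnj (z * poly q z))) +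
            (g z - (poly p' z + cnj (z * poly q' z)))))\<^sup>2)"
        by (simp add: algebra_simps)
      also have "\<dots> \<le> 2 * (LINT z|circle. (cmod (f z - (poly p z + cnj (z * poly q z))))\<^sup>2)
          + 2 * (LINT z|circle. (cmod (g z - (poly p' z + cnj (z * poly q' z))))\<^sup>2)"
        using add by (intro L2_square_integral_add L2_diff trig) auto
      also have "\<dots> < \<epsilon>"
        using * by simp
      finally show ?thesis
        by blast
    qed
    then show ?case
      using add L2_add by blast
  next
    case (scale c f)
    have "\<exists>p q. (LINT z|circle. (cmod (c * f z - (poly p z + cnj (z * poly q z))))\<^sup>2) < \<epsilon>"
      if "\<epsilon> > 0" for \<epsilon>
    proof -
      have pos: "1 + (cmod c)\<^sup>2 > 0"
        by (simp add: add_pos_nonneg)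
      then obtain p q where
        *: "(LINT z|circle. (cmod (f z - (poly p z + cnj (z * poly q z))))\<^sup>2) < \<epsilon> / (1 + (cmod c)\<^sup>2)"
        using scale \<open>\<epsilon> > 0\<close> by (meson divide_pos_pos)
      define I where "I = (LINT z|circle. (cmod (f z - (poly p z + cnj (z * poly q z))))\<^sup>2)"
      have "c * f z - (poly (smult c p) z + cnj (z * poly (smult (cnj c) q) z))
          = c * (f z - (poly p z + cnj (z * poly q z)))" for z
        by (simp add: algebra_simps)
      then have "(LINT z|circle. (cmod (c * f z - (poly (smult c p) z + cnj (z * poly (smult (cnj c) q) z))))\<^sup>2)
          = (cmod c)\<^sup>2 * I"
        by (simp add: I_def norm_mult power_mult_distrib)
      also have "\<dots> \<le> (1 + (cmod c)\<^sup>2) * I"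
        by (intro mult_right_mono) (simp_all add: I_def)
      also have "\<dots> < \<epsilon>"
        using * pos unfolding I_def[symmetric] by (simp add: pos_less_divide_eq mult.commute)
      finally show ?thesis
        by blast
    qed
    then show ?case
      using scale L2_scaleC[of f c] by (simp add: scaleC_complex_def)
  next
    case (limit s f B)
    have f: "f \<in> borel_measurable circle"
      by (rule borel_measurable_LIMSEQ_metric[where f=s and g=f, OF limit(1)]) (simp add: limit)
    have fB: "cmod (f z) \<le> B" if "cmod z = 1" for z
      by (rule LIMSEQ_le_const2[OF tendsto_norm[OF limit(3)[OF that]]]) (auto intro: limit(2)[OF that])
    note [measurable] = f limit(1)
    have fL2: "f \<in> L2"
      by (rule L2_bounded[OF f AE_circleI]) (rule fB)
    have "\<exists>p q. (LINT z|circle. (cmod (f z - (poly p z + cnj (z * poly q z))))\<^sup>2) < \<epsilon>"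
      if "\<epsilon> > 0" for \<epsilon>
    proof -
      have "(\<lambda>n. LINT z|circle. (cmod (f z - s n z))\<^sup>2) \<longlonglongrightarrow> (LINT z|circle. (0::real))"
      proof (rule integral_dominated_convergence[where w="\<lambda>z. (2 * B)\<^sup>2"])
        show "AE z in circle. (\<lambda>n. (cmod (f z - s n z))\<^sup>2) \<longlonglongrightarrow> 0"
        proof (rule AE_circleI)
          fix z :: complex assume "cmod z = 1"
          then have "(\<lambda>n. (cmod (f z - s n z))\<^sup>2) \<longlonglongrightarrow> (cmod (f z - f z))\<^sup>2"
            by (intro tendsto_intros limit)
          then show "(\<lambda>n. (cmod (f z - s n z))\<^sup>2) \<longlonglongrightarrow> 0"
            by simp
        qed
        show "AE z in circle. norm ((cmod (f z - s n z))\<^sup>2) \<le> (2 * B)\<^sup>2" for n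
        proof (rule AE_circleI)
          fix z :: complex assume z: "cmod z = 1"
          have "cmod (f z - s n z) \<le> 2 * B"
            using norm_triangle_ineq4[of "f z" "s n z"] fB[OF z] limit(2)[OF z, of n] by linarith
          then show "norm ((cmod (f z - s n z))\<^sup>2) \<le> (2 * B)\<^sup>2"
            by (simp only: real_norm_def abs_power2) (rule power_mono, auto)
        qed
      qed simp_all
      then have "\<forall>\<^sub>F n in sequentially. (LINT z|circle. (cmod (f z - s n z))\<^sup>2) < \<epsilon> / 4"
        using \<open>\<epsilon> > 0\<close> by (intro order_tendstoD) auto
      then obtain n where n: "(LINT z|circle. (cmod (f z - s n z))\<^sup>2) < \<epsilon> / 4"
        by (meson eventually_happens trivial_limit_sequentially)
      obtain p q where pq: "(LINT z|circle. (cmod (s n z - (poly p z + cnj (z * poly q z))))\<^sup>2) < \<epsilon> / 4"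
        using limit(4)[of n] \<open>\<epsilon> > 0\<close> by (meson divide_pos_pos zero_less_numeral)
      have "(LINT z|circle. (cmod (f z - (poly p z + cnj (z * poly q z))))\<^sup>2)
        = (LINT z|circle. (cmod ((f z - s n z) + (s n z - (poly p z + cnj (z * poly q z)))))\<^sup>2)"
        by (simp only: add_diff_eq diff_add_cancel)
      also have "\<dots> \<le> 2 * (LINT z|circle. (cmod (f z - s n z))\<^sup>2)
          + 2 * (LINT z|circle. (cmod (s n z - (poly p z + cnj (z * poly q z))))\<^sup>2)"
        using limit(4) by (intro L2_square_integral_add L2_diff trig fL2) auto
      also have "\<dots> < \<epsilon>"
        using n pq by simp
      finally show ?thesis
        by blast
    qed
    then show ?case
      using fL2 by blast
  qed
  then show ?thesis
    using assms(3) by blast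
qed

lemma L2_approx:
  fixes h :: "complex \<Rightarrow> complex"
  assumes h: "h \<in> L2" and \<epsilon>: "\<epsilon> > 0"
  shows "\<exists>p q. (LINT z|circle. (cmod (h z - (poly p z + cnj (z * poly q z))))\<^sup>2) < \<epsilon>"
proof -
  note [measurable] = L2_measurable[OF h]
  define t where "t n z = (if cmod (h z) \<le> real n then h z else 0)" for n z
  have t_meas [measurable]: "t n \<in> borel_measurable circle" for n
    unfolding t_def by measurable
  have t_bound: "cmod (t n z) \<le> real n" for n z
    by (simp add: t_def)
  have tL2: "t n \<in> L2" for n
    by (rule L2_bounded[OF t_meas AE_circleI]) (rule t_bound)
  have "(\<lambda>n. LINT z|circle. (cmod (h z - t n z))\<^sup>2) \<longlonglongrightarrow> (LINT z|circle. (0::real))"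
  proof (rule integral_dominated_convergence[where w="\<lambda>z. (cmod (h z))\<^sup>2"])
    show "AE z in circle. (\<lambda>n. (cmod (h z - t n z))\<^sup>2) \<longlonglongrightarrow> 0"
    proof (rule AE_I2)
      fix z :: complex
      obtain N where N: "cmod (h z) \<le> real N"
        using real_arch_simple by blast
      have "\<forall>\<^sub>F n in sequentially. (cmod (h z - t n z))\<^sup>2 = 0"
        unfolding eventually_sequentially by (rule exI[of _ N]) (use N in \<open>auto simp: t_def\<close>)
      then show "(\<lambda>n. (cmod (h z - t n z))\<^sup>2) \<longlonglongrightarrow> 0"
        by (rule tendsto_eventually)
    qed
    show "AE z in circle. norm ((cmod (h z - t n z))\<^sup>2) \<le> (cmod (h z))\<^sup>2" for n
      by (simp add: t_def)
  qed (use h in \<open>simp_all add: L2_integrable_square\<close>)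
  then have "\<forall>\<^sub>F n in sequentially. (LINT z|circle. (cmod (h z - t n z))\<^sup>2) < \<epsilon> / 4"
    using \<epsilon> by (intro order_tendstoD) auto
  then obtain n where n: "(LINT z|circle. (cmod (h z - t n z))\<^sup>2) < \<epsilon> / 4"
    by (meson eventually_happens trivial_limit_sequentially)
  obtain p q where pq: "(LINT z|circle. (cmod (t n z - (poly p z + cnj (z * poly q z))))\<^sup>2) < \<epsilon> / 4"
    using L2_approx_bounded[OF t_meas ballI[OF t_bound], of "\<epsilon> / 4" n] \<epsilon> by auto
  have "(LINT z|circle. (cmod (h z - (poly p z + cnj (z * poly q z))))\<^sup>2)
    = (LINT z|circle. (cmod ((h z - t n z) + (t n z - (poly p z + cnj (z * poly q z)))))\<^sup>2)"
    by (simp only: add_diff_eq diff_add_cancel)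
  also have "\<dots> \<le> 2 * (LINT z|circle. (cmod (h z - t n z))\<^sup>2)
      + 2 * (LINT z|circle. (cmod (t n z - (poly p z + cnj (z * poly q z))))\<^sup>2)"
    using L2_poly[of "[:0, 1:] * q"]
    by (intro L2_square_integral_add L2_diff L2_add L2_poly L2_cnj h tL2) simp
  also have "\<dots> < \<epsilon>"
    using n pq by simp
  finally show ?thesis
    by blast
qed

section \<open>Hardy spaces\<close>

lemma cnj_powi_neg:
  assumes "cmod z = 1"
  shows "cnj z powi (- int m) = z ^ m"
proof -
  have "cnj z ^ m * z ^ m = 1"
    using on_circle[OF assms] by (simp flip: power_mult_distrib)
  then show ?thesis
    by (simp add: power_int_minus inverse_unique)
qed

text \<open>The coefficient of index \<open>- Suc m\<close> is an integral against an ordinary power of \<open>z\<close>.\<close>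

lemma H2_iff: "f \<in> H2 \<longleftrightarrow> f \<in> L2 \<and> (\<forall>m. (LINT z|circle. z ^ Suc m *\<^sub>C f z) = 0)"
proof -
  have eq: "fourier f (- int m) = (LINT z|circle. z ^ m *\<^sub>C f z)" for m
    unfolding fourier_def by (intro Bochner_Integration.integral_cong refl) (simp add: cnj_powi_neg)
  have "(\<forall>n<0. fourier f n = 0) \<longleftrightarrow> (\<forall>m. fourier f (- int (Suc m)) = 0)"
    by (metis neg_int_cases negative_zless_0 Suc_pred)
  then show ?thesis
    by (simp only: H2_def mem_Collect_eq eq)
qed

lemma H2_L2: "f \<in> H2 \<Longrightarrow> f \<in> L2"
  by (simp add: H2_def)

lemma H2_complex_moment: "(h :: complex \<Rightarrow> complex) \<in> H2 \<Longrightarrow> (LINT z|circle. z ^ Suc m * h z) = 0"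
  by (simp only: H2_iff scaleC_complex_def)

lemma H2_add:
  assumes "f \<in> H2" and "g \<in> H2"
  shows "(\<lambda>z. f z + g z) \<in> H2"
proof -
  have "(LINT z|circle. z ^ n *\<^sub>C (f z + g z)) = (LINT z|circle. z ^ n *\<^sub>C f z) + (LINT z|circle. z ^ n *\<^sub>C g z)" for n
    unfolding scaleC_add_right
    by (intro Bochner_Integration.integral_add L2_integrable L2_power H2_L2 assms)
  then show ?thesis
    using assms by (simp add: H2_iff L2_add del: power_Suc)
qed

lemma H2_scaleC:
  assumes "f \<in> H2"
  shows "(\<lambda>z. c *\<^sub>C f z) \<in> H2"
proof -
  have "(LINT z|circle. z ^ n *\<^sub>C c *\<^sub>C f z) = c *\<^sub>C (LINT z|circle. z ^ n *\<^sub>C f z)" for n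
  proof -
    have "(LINT z|circle. z ^ n *\<^sub>C c *\<^sub>C f z) = (LINT z|circle. c *\<^sub>C z ^ n *\<^sub>C f z)"
      by (simp add: scaleC_scaleC mult.commute)
    also have "\<dots> = c *\<^sub>C (LINT z|circle. z ^ n *\<^sub>C f z)"
      by (intro integral_bounded_linear bounded_bilinear.bounded_linear_right[OF bounded_bilinear_scaleC]
          L2_integrable L2_power H2_L2 assms)
    finally show ?thesis .
  qed
  then show ?thesis
    using assms by (simp add: H2_iff L2_scaleC del: power_Suc)
qed

lemma H2_diff:
  assumes "f \<in> H2" and "g \<in> H2"
  shows "(\<lambda>z. f z - g z) \<in> H2"
  using H2_add[OF assms(1) H2_scaleC[OF assms(2), of "-1"]] by (simp add: scaleC_minus_one)

lemma H2_power:
  assumes "f \<in> H2"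
  shows "(\<lambda>z. z ^ n *\<^sub>C f z) \<in> H2"
proof -
  have "(LINT z|circle. z ^ Suc m *\<^sub>C z ^ n *\<^sub>C f z) = (LINT z|circle. z ^ Suc (m + n) *\<^sub>C f z)" for m
    by (simp add: scaleC_scaleC power_add mult.assoc)
  then show ?thesis
    using assms by (simp add: H2_iff L2_power del: power_Suc)
qed

lemma cinner_moment:
  assumes "f \<in> L2"
  shows "cinner (LINT z|circle. z ^ n *\<^sub>C f z) x = (LINT z|circle. z ^ n * cinner (f z) x)"
  by (subst integral_bounded_linear[symmetric,
        OF bounded_bilinear.bounded_linear_left[OF bounded_bilinear_cinner]])
    (use assms in \<open>simp_all add: L2_integrable L2_power cinner_scaleC_left\<close>)

lemma H2_from_cinner:
  assumes f: "f \<in> L2" and "\<And>m x. (LINT z|circle. z ^ Suc m * cinner (f z) x) = 0"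
  shows "f \<in> H2"
proof -
  have "(LINT z|circle. z ^ Suc m *\<^sub>C f z) = 0" for m
    by (rule cinner_eqI) (simp only: cinner_moment[OF f] assms(2) cinner_zero_left)
  then show ?thesis
    using f by (simp add: H2_iff)
qed

lemma L2_cinner:
  assumes "f \<in> L2"
  shows "(\<lambda>z. cinner (f z) x) \<in> L2"
proof (rule L2_bound[OF assms, of _ "norm x"])
  show "(\<lambda>z. cinner (f z) x) \<in> borel_measurable circle"
    using L2_measurable[OF assms] by measurable
  show "AE z in circle. norm (cinner (f z) x) \<le> norm x * norm (f z)"
    by (rule AE_circleI) (metis cinner_Cauchy_Schwarz mult.commute)
qed

lemma H2_cinner:
  assumes "f \<in> H2"
  shows "(\<lambda>z. cinner (f z) x) \<in> H2"
proof -
  have "(LINT z|circle. z ^ Suc m * cinner (f z) x) = 0" for m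
    using assms cinner_moment[of f "Suc m" x] by (simp only: H2_iff cinner_zero_left)
  then show ?thesis
    using assms by (simp add: H2_iff L2_cinner scaleC_complex_def del: power_Suc)
qed

lemma H2_const: "(\<lambda>z. x) \<in> H2"
proof (rule H2_from_cinner[OF L2_const])
  show "(LINT z|circle. z ^ Suc m * cinner x y) = 0" for m y
    using integral_circle_power[of "Suc m"] by simp
qed

lemma H2_poly_mult: "f \<in> H2 \<Longrightarrow> (\<lambda>z. poly p z * f z) \<in> H2"
proof (induction p)
  case 0
  show ?case
    using H2_const[of 0] by simp
next
  case (pCons a p)
  have "(\<lambda>z. a *\<^sub>C f z + z ^ 1 *\<^sub>C (poly p z * f z)) \<in> H2"
    by (intro H2_add H2_scaleC H2_power pCons)
  then show ?case
    by (simp add: scaleC_complex_def algebra_simps)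
qed

lemma H2_poly: "(\<lambda>z. poly p z) \<in> H2"
  using H2_poly_mult[OF H2_const[of 1], of p] by simp

text \<open>Approximate \<open>h\<close> in mean square by \<open>p(z) + cnj (z q(z))\<close>.  The anti-analytic part is orthogonal
  to \<open>h - p\<close>, so \<open>p\<close> alone approximates at least as well, and for a polynomial in place of \<open>h\<close> the
  claim only involves vanishing moments of \<open>k\<close>.\<close>

lemma H2_mult_moment:
  fixes h k :: "complex \<Rightarrow> complex"
  assumes h: "h \<in> H2" and k: "k \<in> H2"
  shows "(LINT z|circle. z ^ Suc m * (h z * k z)) = 0" (is "?I = 0")
proof -
  define K where "K = (LINT z|circle. (cmod (k z))\<^sup>2)"
  have bound: "cmod ?I \<le> \<delta> * (1 + K)" if \<delta>: "\<delta> > 0" for \<delta>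
  proof -
    obtain p q where pq: "(LINT z|circle. (cmod (h z - (poly p z + cnj (z * poly q z))))\<^sup>2) < \<delta>\<^sup>2"
      using L2_approx[OF H2_L2[OF h], of "\<delta>\<^sup>2"] \<delta> by auto
    define u where "u z = h z - poly p z" for z
    define w where "w z = z * poly q z" for z
    have u: "u \<in> H2"
      unfolding u_def using h H2_poly by (rule H2_diff)
    then have uL: "u \<in> L2"
      by (rule H2_L2)
    have wL: "w \<in> L2"
      using L2_poly[of "[:0, 1:] * q"] by (simp add: w_def[abs_def])
    have uw: "(LINT z|circle. u z * w z) = 0"
      using H2_complex_moment[OF H2_poly_mult[OF u, of q], of 0] by (simp add: w_def mult_ac)
    define r where "r z = Re (u z * w z)" for z
    have r: "integrable circle r" "(LINT z|circle. r z) = 0"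
      using integrable_mult[OF uL wL] uw unfolding r_def
      by (simp_all only: integrable_Re integral_Re zero_complex.sel)
    have "(LINT z|circle. (cmod (u z))\<^sup>2) \<le> (LINT z|circle. (cmod (u z))\<^sup>2 + (cmod (w z))\<^sup>2)"
      by (intro integral_mono) (use uL wL in \<open>simp_all add: L2_integrable_square\<close>)
    also have "\<dots> = (LINT z|circle. (cmod (u z))\<^sup>2 + (cmod (w z))\<^sup>2 - 2 * r z)"
      using uL wL r by (simp add: L2_integrable_square)
    also have "\<dots> = (LINT z|circle. (cmod (u z - cnj (w z)))\<^sup>2)"
      by (intro Bochner_Integration.integral_cong refl)
        (simp only: r_def cmod_power2, simp add: power2_eq_square algebra_simps)
    also have "\<dots> = (LINT z|circle. (cmod (h z - (poly p z + cnj (z * poly q z))))\<^sup>2)"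
      by (simp only: u_def w_def diff_diff_eq)
    also note pq
    finally have small: "(LINT z|circle. (cmod (u z))\<^sup>2) < \<delta>\<^sup>2" .
    have p0: "(LINT z|circle. z ^ Suc m * (poly p z * k z)) = 0"
      using H2_complex_moment[OF H2_poly_mult[OF k]] .
    have "?I = (LINT z|circle. z ^ Suc m * (u z * k z) + z ^ Suc m * (poly p z * k z))"
      by (simp add: u_def algebra_simps)
    also have "\<dots> = (LINT z|circle. z ^ Suc m * (u z * k z))"
    proof (subst Bochner_Integration.integral_add)
      show "integrable circle (\<lambda>z. z ^ Suc m * (u z * k z))"
        using integrable_mult[OF L2_power[OF uL, of "Suc m"] H2_L2[OF k]]
        by (simp add: scaleC_complex_def mult_ac)
      show "integrable circle (\<lambda>z. z ^ Suc m * (poly p z * k z))"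
        using L2_integrable[OF L2_power[OF H2_L2[OF H2_poly_mult[OF k]], of "Suc m"]]
        by (simp add: scaleC_complex_def mult_ac)
    qed (use p0 in simp)
    finally have "cmod ?I = cmod (LINT z|circle. z ^ Suc m * (u z * k z))"
      by simp
    also have "\<dots> \<le> (LINT z|circle. cmod (z ^ Suc m * (u z * k z)))"
      by (rule integral_norm_bound)
    \<comment> \<open>the weights \<open>1 / \<delta>\<close> and \<open>\<delta>\<close> make both terms of order \<open>\<delta>\<close>\<close>
    also have "\<dots> \<le> (LINT z|circle. (1 / \<delta>) * (cmod (u z))\<^sup>2 + \<delta> * (cmod (k z))\<^sup>2)"
    proof (rule integral_mono')
      fix z :: complex assume "z \<in> space circle"
      then have "cmod (z ^ Suc m * (u z * k z)) = cmod (u z) * cmod (k z)"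
        by (simp add: norm_mult norm_power)
      moreover have "0 \<le> (cmod (u z) - \<delta> * cmod (k z))\<^sup>2"
        by simp
      then have "2 * \<delta> * (cmod (u z) * cmod (k z)) \<le> (cmod (u z))\<^sup>2 + \<delta>\<^sup>2 * (cmod (k z))\<^sup>2"
        by (simp add: power2_eq_square algebra_simps)
      then have "2 * (cmod (u z) * cmod (k z)) \<le> (1 / \<delta>) * (cmod (u z))\<^sup>2 + \<delta> * (cmod (k z))\<^sup>2"
        using \<delta> by (simp add: field_simps power2_eq_square)
      moreover have "0 \<le> cmod (u z) * cmod (k z)"
        by simp
      ultimately show "cmod (z ^ Suc m * (u z * k z)) \<le> (1 / \<delta>) * (cmod (u z))\<^sup>2 + \<delta> * (cmod (k z))\<^sup>2"
        by linarith
    qed (use uL H2_L2[OF k] \<delta> in \<open>simp_all add: L2_integrable_square\<close>)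
    also have "\<dots> = (1 / \<delta>) * (LINT z|circle. (cmod (u z))\<^sup>2) + \<delta> * K"
      unfolding K_def using uL H2_L2[OF k] by (simp add: L2_integrable_square)
    also have "\<dots> \<le> (1 / \<delta>) * \<delta>\<^sup>2 + \<delta> * K"
      using small \<delta> by (intro add_right_mono mult_left_mono) auto
    also have "\<dots> = \<delta> * (1 + K)"
      using \<delta> by (simp add: power2_eq_square algebra_simps)
    finally show ?thesis .
  qed
  have K: "1 + K > 0"
    unfolding K_def by (simp add: add_pos_nonneg)
  have "cmod ?I \<le> 0"
  proof (rule field_le_epsilon)
    fix e :: real assume "e > 0"
    then show "cmod ?I \<le> 0 + e"
      using bound[of "e / (1 + K)"] K by simp
  qed
  then show ?thesis
    by simp
qed

lemma H2_cong_AE: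
  assumes "f \<in> H2" and "g \<in> borel_measurable circle" and "AE z in circle. f z = g z"
  shows "g \<in> H2"
proof -
  note [measurable] = assms(2) L2_measurable[OF H2_L2[OF assms(1)]]
  have "(LINT z|circle. z ^ n *\<^sub>C g z) = (LINT z|circle. z ^ n *\<^sub>C f z)" for n
    by (rule integral_cong_AE) (use assms(3) in \<open>measurable, eventually_elim, simp\<close>)
  then show ?thesis
    using assms(1) L2_cong_AE[OF H2_L2[OF assms(1)] assms(2,3)] by (simp add: H2_iff del: power_Suc)
qed

lemma LinfI:
  assumes "\<And>z. cmod z = 1 \<Longrightarrow> bounded_clinear (F z)" and "\<And>x. (\<lambda>z. F z x) \<in> borel_measurable circle"
    and "AE z in circle. \<forall>x. norm (F z x) \<le> M * norm x"
  shows "F \<in> Linf"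
proof -
  have "AE z in circle. onorm (F z) \<le> max M 0"
    using assms(3)
  proof eventually_elim
    case (elim z)
    show ?case
    proof (rule onorm_bound)
      show "norm (F z x) \<le> max M 0 * norm x" for x
        using elim by (rule allE[of _ x]) (meson max.cobounded1 mult_right_mono norm_ge_zero order_trans)
    qed simp
  qed
  then show ?thesis
    using assms unfolding Linf_def by auto
qed

lemma Linf_bounded_clinear: "F \<in> Linf \<Longrightarrow> cmod z = 1 \<Longrightarrow> bounded_clinear (F z)"
  by (simp add: Linf_def)

lemma Linf_measurable: "F \<in> Linf \<Longrightarrow> (\<lambda>z. F z x) \<in> borel_measurable circle"
  by (simp add: Linf_def)

lemma Linf_bound:
  assumes "F \<in> Linf"
  obtains M where "M \<ge> 0" and "AE z in circle. \<forall>x. norm (F z x) \<le> M * norm x"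
proof -
  obtain M where M: "AE z in circle. onorm (F z) \<le> M"
    using assms unfolding Linf_def by blast
  have "AE z in circle. cmod z = 1"
    by (rule AE_circleI)
  then have "AE z in circle. \<forall>x. norm (F z x) \<le> max M 0 * norm x"
    using M
  proof eventually_elim
    case (elim z)
    then have bl: "bounded_linear (F z)"
      using Linf_bounded_clinear[OF assms] by (simp add: bounded_clinear_def)
    show ?case
    proof
      fix x
      have "norm (F z x) \<le> onorm (F z) * norm x"
        using bl by (rule onorm)
      also have "\<dots> \<le> max M 0 * norm x"
        using elim by (intro mult_right_mono) auto
      finally show "norm (F z x) \<le> max M 0 * norm x" .
    qed
  qed
  then show ?thesis
    using that[of "max M 0"] by simp
qed

text \<open>Measurability of \<open>F\<close> is only known on fixed vectors; expanding \<open>f z\<close> in a fixed basis reduces to them.\<close>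

lemma Linf_apply_measurable:
  assumes F: "F \<in> Linf" and f: "f \<in> borel_measurable circle"
  shows "(\<lambda>z. F z (f z)) \<in> borel_measurable circle"
proof -
  obtain E :: "'a set" where E: "orthonormal_basis E"
    using orthonormal_basis_exists by blast
  note [measurable] = f Linf_measurable[OF F]
  have "(\<lambda>z. \<Sum>e\<in>E. cinner (f z) e *\<^sub>C F z e) \<in> borel_measurable circle"
    by measurable
  moreover have "(\<Sum>e\<in>E. cinner (f z) e *\<^sub>C F z e) = F z (f z)" if "z \<in> space circle" for z
    using bounded_clinear_expand[OF Linf_bounded_clinear[OF F] E] that by simp
  ultimately show ?thesis
    by (subst measurable_cong[where g="\<lambda>z. \<Sum>e\<in>E. cinner (f z) e *\<^sub>C F z e"]) simp_all
qed

lemma Linf_apply_L2: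
  assumes F: "F \<in> Linf" and f: "f \<in> L2"
  shows "(\<lambda>z. F z (f z)) \<in> L2"
proof -
  obtain M where "AE z in circle. \<forall>x. norm (F z x) \<le> M * norm x"
    using Linf_bound[OF F] by blast
  then have "AE z in circle. norm (F z (f z)) \<le> M * norm (f z)"
    by eventually_elim blast
  then show ?thesis
    by (rule L2_bound[OF f Linf_apply_measurable[OF F L2_measurable[OF f]]])
qed

lemma Linf_compose:
  assumes F: "F \<in> Linf" and G: "G \<in> Linf"
  shows "(\<lambda>z. F z \<circ> G z) \<in> Linf"
proof -
  obtain M where M: "M \<ge> 0" "AE z in circle. \<forall>x. norm (F z x) \<le> M * norm x"
    using Linf_bound[OF F] by blast
  obtain N where N: "AE z in circle. \<forall>x. norm (G z x) \<le> N * norm x"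
    using Linf_bound[OF G] by blast
  show ?thesis
  proof (rule LinfI)
    show "AE z in circle. \<forall>x. norm ((F z \<circ> G z) x) \<le> (M * N) * norm x"
      using M(2) N
    proof eventually_elim
      case (elim z)
      show ?case
      proof
        fix x
        have "norm (F z (G z x)) \<le> M * norm (G z x)"
          using elim by blast
        also have "\<dots> \<le> M * (N * norm x)"
          using elim M(1) by (intro mult_left_mono) auto
        finally show "norm ((F z \<circ> G z) x) \<le> (M * N) * norm x"
          by simp
      qed
    qed
    show "(\<lambda>z. (F z \<circ> G z) x) \<in> borel_measurable circle" for x
      using Linf_apply_measurable[OF F Linf_measurable[OF G]] by simp
  qed (use assms in \<open>simp add: bounded_clinear_compose Linf_bounded_clinear\<close>)
qed

lemma Linf_const:
  assumes "bounded_clinear A"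
  shows "(\<lambda>z. A) \<in> Linf"
proof (rule LinfI)
  have "bounded_linear A"
    using assms by (simp add: bounded_clinear_def)
  then show "AE z in circle. \<forall>x. norm (A x) \<le> onorm A * norm x"
    by (simp add: onorm)
qed (use assms in simp_all)

lemma Linf_diff:
  assumes F: "F \<in> Linf" and G: "G \<in> Linf"
  shows "(\<lambda>z x. F z x - G z x) \<in> Linf"
proof -
  obtain M where M: "AE z in circle. \<forall>x. norm (F z x) \<le> M * norm x"
    using Linf_bound[OF F] by blast
  obtain N where N: "AE z in circle. \<forall>x. norm (G z x) \<le> N * norm x"
    using Linf_bound[OF G] by blast
  show ?thesis
  proof (rule LinfI)
    show "AE z in circle. \<forall>x. norm (F z x - G z x) \<le> (M + N) * norm x"
      using M N
    proof eventually_elim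
      case (elim z)
      show ?case
      proof
        show "norm (F z x - G z x) \<le> (M + N) * norm x" for x
          using elim norm_triangle_ineq4[of "F z x" "G z x"] by (smt (verit, best) distrib_right)
      qed
    qed
    show "(\<lambda>z. F z x - G z x) \<in> borel_measurable circle" for x
      using assms by (intro borel_measurable_diff Linf_measurable)
    show "bounded_clinear (\<lambda>x. F z x - G z x)" if "cmod z = 1" for z
      using Linf_bounded_clinear[OF F that] Linf_bounded_clinear[OF G that]
      by (intro bounded_clinearI) (simp_all add: bounded_clinear_add bounded_clinear_scaleC scaleC_diff_right)
  qed
qed

lemma Linf_cadjoint:
  assumes F: "F \<in> Linf"
  shows "(\<lambda>z. cadjoint (F z)) \<in> Linf"
proof -
  obtain M where M: "M \<ge> 0" "AE z in circle. \<forall>x. norm (F z x) \<le> M * norm x"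
    using Linf_bound[OF F] by blast
  have circ: "AE z in circle. cmod z = 1"
    by (rule AE_circleI)
  obtain E :: "'a set" where E: "orthonormal_basis E"
    using orthonormal_basis_exists by blast
  show ?thesis
  proof (rule LinfI)
    show "AE z in circle. \<forall>x. norm (cadjoint (F z) x) \<le> M * norm x"
      using M(2) circ
    proof eventually_elim
      case (elim z)
      note A = Linf_bounded_clinear[OF F elim(2)]
      show ?case
      proof
        fix x
        let ?y = "cadjoint (F z) x"
        have "norm ?y * norm ?y = cmod (cinner ?y ?y)"
          by (simp add: cinner_self power2_eq_square norm_mult)
        also have "\<dots> = cmod (cinner x (F z ?y))"
          by (simp add: cinner_cadjoint_left[OF A])
        also have "\<dots> \<le> norm x * norm (F z ?y)"
          by (rule cinner_Cauchy_Schwarz)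
        also have "\<dots> \<le> norm x * (M * norm ?y)"
          using elim by (intro mult_left_mono) auto
        finally have "norm ?y * norm ?y \<le> (M * norm x) * norm ?y"
          by (simp add: mult_ac)
        then show "norm ?y \<le> M * norm x"
          using M(1) by (cases "norm ?y = 0") (auto simp: mult_le_cancel_right)
      qed
    qed
    fix x
    note [measurable] = Linf_measurable[OF F]
    have "(\<lambda>z. \<Sum>e\<in>E. cinner x (F z e) *\<^sub>C e) \<in> borel_measurable circle"
      by measurable
    moreover have "(\<Sum>e\<in>E. cinner x (F z e) *\<^sub>C e) = cadjoint (F z) x" if "z \<in> space circle" for z
    proof -
      have "bounded_clinear (F z)"
        using Linf_bounded_clinear[OF F] that by simp
      then have "(\<Sum>e\<in>E. cinner x (F z e) *\<^sub>C e) = (\<Sum>e\<in>E. cinner (cadjoint (F z) x) e *\<^sub>C e)"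
        by (simp add: cinner_cadjoint_left)
      then show ?thesis
        using E unfolding orthonormal_basis_def by metis
    qed
    ultimately show "(\<lambda>z. cadjoint (F z) x) \<in> borel_measurable circle"
      by (subst measurable_cong[where g="\<lambda>z. \<Sum>e\<in>E. cinner x (F z e) *\<^sub>C e"]) simp_all
  qed (use F in \<open>simp add: bounded_clinear_cadjoint Linf_bounded_clinear\<close>)
qed

lemma Linf_conjugations:
  assumes F: "F \<in> Linf" and J: "conjugation J" and J': "conjugation J'"
  shows "(\<lambda>z. J \<circ> F z \<circ> J') \<in> Linf"
proof -
  obtain M where "AE z in circle. \<forall>x. norm (F z x) \<le> M * norm x"
    using Linf_bound[OF F] by blast
  then have M: "AE z in circle. \<forall>x. norm ((J \<circ> F z \<circ> J') x) \<le> M * norm x"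
    by eventually_elim (metis comp_apply conjugationD(7) J J')
  show ?thesis
    by (rule LinfI[OF _ _ M])
      (use Linf_bounded_clinear[OF F] Linf_measurable[OF F] in
        \<open>simp_all add: conjugation_compose_bounded_clinear[unfolded o_def] J J' borel_measurable_conjugation[OF J]\<close>)
qed

lemma Hinf_iff: "F \<in> Hinf \<longleftrightarrow> F \<in> Linf \<and> (\<forall>x. (\<lambda>z. F z x) \<in> H2)"
proof -
  have "(\<lambda>z. F z x) \<in> L2" if "F \<in> Linf" for x
    using Linf_apply_L2[OF that L2_const] .
  then show ?thesis
    unfolding Hinf_def H2_def op_fourier_def by (auto simp: fun_eq_iff)
qed

lemma Hinf_Linf: "F \<in> Hinf \<Longrightarrow> F \<in> Linf"
  by (simp add: Hinf_def)

lemma Hinf_H2: "F \<in> Hinf \<Longrightarrow> (\<lambda>z. F z x) \<in> H2"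
  by (simp add: Hinf_iff)

lemma Hinf_const: "bounded_clinear A \<Longrightarrow> (\<lambda>z. A) \<in> Hinf"
  by (simp add: Hinf_iff Linf_const H2_const)

lemma Hinf_diff: "F \<in> Hinf \<Longrightarrow> G \<in> Hinf \<Longrightarrow> (\<lambda>z x. F z x - G z x) \<in> Hinf"
  by (simp add: Hinf_iff Linf_diff H2_diff)

lemma Hinf_add:
  assumes "F \<in> Hinf" and "G \<in> Hinf"
  shows "(\<lambda>z x. F z x + G z x) \<in> Hinf"
proof -
  have "(\<lambda>z x. 0) \<in> Hinf"
    by (intro Hinf_const bounded_clinearI) simp_all
  from Hinf_diff[OF assms(1) Hinf_diff[OF this assms(2)]] show ?thesis
    by simp
qed

lemma Hinf_cong_AE:
  assumes "F \<in> Hinf" and "G \<in> Linf" and "AE z in circle. F z = G z"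
  shows "G \<in> Hinf"
proof -
  have "(\<lambda>z. G z x) \<in> H2" for x
    by (rule H2_cong_AE[OF Hinf_H2[OF assms(1)] Linf_measurable[OF assms(2)]])
      (use assms(3) in \<open>eventually_elim, simp\<close>)
  then show ?thesis
    using assms(2) by (simp add: Hinf_iff)
qed

text \<open>In coordinates this is a finite sum of products of scalar functions in \<open>H\<^sup>2\<close>.\<close>

lemma Hinf_apply_H2:
  assumes F: "F \<in> Hinf" and g: "g \<in> H2"
  shows "(\<lambda>z. F z (g z)) \<in> H2"
proof (rule H2_from_cinner)
  show "(\<lambda>z. F z (g z)) \<in> L2"
    using Linf_apply_L2[OF Hinf_Linf[OF F] H2_L2[OF g]] .
  obtain E :: "'a set" where E: "orthonormal_basis E"
    using orthonormal_basis_exists by blast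
  fix m y
  have "(LINT z|circle. z ^ Suc m * cinner (F z (g z)) y)
      = (LINT z|circle. (\<Sum>e\<in>E. z ^ Suc m * (cinner (g z) e * cinner (F z e) y)))"
  proof (intro Bochner_Integration.integral_cong refl)
    fix z :: complex assume "z \<in> space circle"
    then have "F z (g z) = (\<Sum>e\<in>E. cinner (g z) e *\<^sub>C F z e)"
      using bounded_clinear_expand[OF Linf_bounded_clinear[OF Hinf_Linf[OF F]] E] by simp
    then show "z ^ Suc m * cinner (F z (g z)) y = (\<Sum>e\<in>E. z ^ Suc m * (cinner (g z) e * cinner (F z e) y))"
      by (simp add: cinner_sum_left cinner_scaleC_left sum_distrib_left)
  qed
  also have "\<dots> = (\<Sum>e\<in>E. LINT z|circle. z ^ Suc m * (cinner (g z) e * cinner (F z e) y))"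
  proof (rule Bochner_Integration.integral_sum)
    fix e
    have "(\<lambda>z. z ^ Suc m * cinner (g z) e) \<in> L2"
      using L2_power[OF L2_cinner[OF H2_L2[OF g]]] by (simp only: scaleC_complex_def)
    from integrable_mult[OF this L2_cinner[OF H2_L2[OF Hinf_H2[OF F]]]]
    show "integrable circle (\<lambda>z. z ^ Suc m * (cinner (g z) e * cinner (F z e) y))"
      by (simp only: mult.assoc)
  qed
  also have "\<dots> = 0"
    by (intro sum.neutral ballI H2_mult_moment H2_cinner Hinf_H2 F g)
  finally show "(LINT z|circle. z ^ Suc m * cinner (F z (g z)) y) = 0" .
qed

lemma Hinf_compose: "F \<in> Hinf \<Longrightarrow> G \<in> Hinf \<Longrightarrow> (\<lambda>z. F z \<circ> G z) \<in> Hinf"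
  by (auto simp: Hinf_iff Linf_compose intro: Hinf_apply_H2[unfolded Hinf_iff])

text \<open>Taking adjoints replaces \<open>z\<close> by its conjugate and antilinear maps undo this: up to the order
  of the arguments, the matrix coefficients of \<open>J F\<^sup>* J'\<close> are those of \<open>F\<close>.\<close>

lemma Hinf_conjugated_cadjoint:
  assumes F: "F \<in> Hinf" and J: "conjugation J" and J': "conjugation J'"
  shows "(\<lambda>z. J \<circ> cadjoint (F z) \<circ> J') \<in> Hinf"
proof -
  have L: "(\<lambda>z. J \<circ> cadjoint (F z) \<circ> J') \<in> Linf"
    by (intro Linf_conjugations Linf_cadjoint Hinf_Linf F J J')
  have "(\<lambda>z. (J \<circ> cadjoint (F z) \<circ> J') x) \<in> H2" for x
  proof (rule H2_from_cinner)
    show "(\<lambda>z. (J \<circ> cadjoint (F z) \<circ> J') x) \<in> L2"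
      using Linf_apply_L2[OF L L2_const] .
    fix m y
    have "(LINT z|circle. z ^ Suc m * cinner ((J \<circ> cadjoint (F z) \<circ> J') x) y)
        = (LINT z|circle. z ^ Suc m * cinner (F z (J y)) (J' x))"
    proof (intro Bochner_Integration.integral_cong refl)
      fix z :: complex assume "z \<in> space circle"
      then have "bounded_clinear (F z)"
        using Linf_bounded_clinear[OF Hinf_Linf[OF F]] by simp
      then show "z ^ Suc m * cinner ((J \<circ> cadjoint (F z) \<circ> J') x) y = z ^ Suc m * cinner (F z (J y)) (J' x)"
        by (simp add: conjugationD(5)[OF J, of _ y] cinner_cadjoint)
    qed
    also have "\<dots> = 0"
      by (intro H2_complex_moment H2_cinner Hinf_H2 F)
    finally show "(LINT z|circle. z ^ Suc m * cinner ((J \<circ> cadjoint (F z) \<circ> J') x) y) = 0" .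
  qed
  then show ?thesis
    using L by (simp add: Hinf_iff)
qed

section \<open>Model spaces\<close>

lemma inner_function_Hinf: "inner_function \<Gamma> \<Longrightarrow> \<Gamma> \<in> Hinf"
  by (simp add: inner_function_def)

lemma inner_function_Linf: "inner_function \<Gamma> \<Longrightarrow> \<Gamma> \<in> Linf"
  by (simp add: inner_function_Hinf Hinf_Linf)

lemma inner_function_unitary: "inner_function \<Gamma> \<Longrightarrow> AE z in circle. unitary (\<Gamma> z)"
  by (simp add: inner_function_def)

lemma symmetric_wrt_swap:
  assumes J: "conjugation J" and "symmetric_wrt J \<Gamma>"
  shows "AE z in circle. \<forall>x. \<Gamma> z (J x) = J (cadjoint (\<Gamma> z) x)"
  using assms(2) unfolding symmetric_wrt_def
proof eventually_elim
  case (elim z)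
  show ?case
    unfolding elim[symmetric] by (simp add: conjugationD(3)[OF J])
qed

lemma L2_conjugation_apply:
  assumes J: "conjugation J" and f: "f \<in> L2"
  shows "(\<lambda>z. J (f z)) \<in> L2"
  by (rule L2_bound[OF f, of _ 1])
    (simp_all add: borel_measurable_conjugation[OF J] L2_measurable[OF f] conjugationD(7)[OF J])

lemma model_conj_L2:
  assumes "\<Gamma> \<in> Linf" and "conjugation J" and "f \<in> L2"
  shows "model_conj \<Gamma> J f \<in> L2"
  unfolding model_conj_def
  by (rule Linf_apply_L2[OF assms(1) L2_cnj_mult[OF L2_conjugation_apply[OF assms(2,3)]]])

lemma inner_le_refl:
  assumes "inner_function \<Lambda>"
  shows "inner_le \<Lambda> \<Lambda>"
  unfolding inner_le_def
proof (rule Hinf_cong_AE)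
  show "(\<lambda>z x. x) \<in> Hinf"
    by (intro Hinf_const bounded_clinearI) simp_all
  show "(\<lambda>z. cadjoint (\<Lambda> z) \<circ> \<Lambda> z) \<in> Linf"
    by (intro Linf_compose Linf_cadjoint inner_function_Linf assms)
  show "AE z in circle. (\<lambda>x. x) = cadjoint (\<Lambda> z) \<circ> \<Lambda> z"
    using inner_function_unitary[OF assms] by eventually_elim (simp add: fun_eq_iff unitaryD)
qed

lemma model_space_cong_AE:
  assumes "f \<in> model_space \<Theta>" and \<Theta>: "inner_function \<Theta>" and g: "g \<in> borel_measurable circle"
    and ae: "AE z in circle. f z = g z"
  shows "g \<in> model_space \<Theta>"
proof -
  have f: "f \<in> H2" "\<And>h. h \<in> H2 \<Longrightarrow> L2_inner f (\<lambda>z. \<Theta> z (h z)) = 0"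
    using assms(1) unfolding model_space_def by auto
  have "L2_inner g (\<lambda>z. \<Theta> z (h z)) = L2_inner f (\<lambda>z. \<Theta> z (h z))" if h: "h \<in> H2" for h
  proof -
    note [measurable] = g L2_measurable[OF H2_L2[OF f(1)]]
      Linf_apply_measurable[OF inner_function_Linf[OF \<Theta>] L2_measurable[OF H2_L2[OF h]]]
    show ?thesis
      unfolding L2_inner_def by (rule integral_cong_AE) (use ae in \<open>measurable, eventually_elim, simp\<close>)
  qed
  then show ?thesis
    using f H2_cong_AE[OF f(1) g ae] unfolding model_space_def by simp
qed

text \<open>The factor \<open>J (f z)\<close> contributes only non-positive frequencies, \<open>cnj z\<close> makes them negative,
  and \<open>h\<close> has none.\<close>

lemma conjugated_H2_orthogonal:
  assumes f: "f \<in> H2" and h: "h \<in> H2" and J: "conjugation J"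
  shows "(LINT z|circle. cinner (cnj z *\<^sub>C J (f z)) (h z)) = 0"
proof -
  obtain E :: "'a set" where E: "orthonormal_basis E"
    using orthonormal_basis_exists by blast
  have eq: "cinner (cnj z *\<^sub>C J (f z)) (h z) = cnj (\<Sum>e\<in>E. z ^ Suc 0 * (cinner (h z) e * cinner (f z) (J e)))" for z
  proof -
    have "cinner (h z) (cnj z *\<^sub>C J (f z)) = z * (\<Sum>e\<in>E. cinner (h z) e * cinner e (J (f z)))"
      unfolding cinner_scaleC_right orthonormal_basis_cinner[OF E, of "h z" "J (f z)"] by simp
    also have "\<dots> = (\<Sum>e\<in>E. z ^ Suc 0 * (cinner (h z) e * cinner (f z) (J e)))"
      by (simp add: sum_distrib_left conjugationD(6)[OF J, of _ "f z"])
    finally show ?thesis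
      by (metis cinner_commute)
  qed
  have int: "integrable circle (\<lambda>z. z ^ Suc 0 * (cinner (h z) e * cinner (f z) (J e)))" for e
  proof -
    have "(\<lambda>z. z ^ Suc 0 * cinner (h z) e) \<in> L2"
      using L2_power[OF L2_cinner[OF H2_L2[OF h]]] by (simp only: scaleC_complex_def)
    from integrable_mult[OF this L2_cinner[OF H2_L2[OF f]]]
    show ?thesis
      by (simp only: mult.assoc)
  qed
  have "(LINT z|circle. (\<Sum>e\<in>E. z ^ Suc 0 * (cinner (h z) e * cinner (f z) (J e)))) = 0"
    unfolding Bochner_Integration.integral_sum[OF int]
    by (intro sum.neutral ballI H2_mult_moment H2_cinner f h)
  then show ?thesis
    by (simp only: eq Bochner_Integration.integral_cnj complex_cnj_zero)
qed

text \<open>The two halves of the hypothesis act separately.  Pairing \<open>model_conj \<Gamma> J f\<close> with a negative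
  frequency pairs \<open>f\<close> with \<open>\<Gamma> z\<^sup>m = \<Lambda> (\<Lambda>\<^sup>* \<Gamma>) z\<^sup>m\<close>, an element of \<open>\<Lambda> H\<^sup>2\<close>; pairing it with \<open>\<Theta> g\<close> pairs
  \<open>cnj z J f\<close> with \<open>\<Gamma>\<^sup>* \<Theta> g\<close>, an element of \<open>H\<^sup>2\<close>.\<close>

lemma model_conj_model_space:
  assumes \<Theta>: "inner_function \<Theta>" and \<Lambda>: "inner_function \<Lambda>" and \<Gamma>: "inner_function \<Gamma>"
    and J: "conjugation J" and sym: "symmetric_wrt J \<Gamma>"
    and le: "inner_le \<Lambda> \<Gamma>" "inner_le \<Gamma> \<Theta>" and f: "f \<in> model_space \<Lambda>"
  shows "model_conj \<Gamma> J f \<in> model_space \<Theta>"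
proof -
  have fH: "f \<in> H2" and orth: "\<And>g. g \<in> H2 \<Longrightarrow> L2_inner f (\<lambda>z. \<Lambda> z (g z)) = 0"
    using f unfolding model_space_def by auto
  have fL: "f \<in> L2"
    using fH by (rule H2_L2)
  have uL: "model_conj \<Gamma> J f \<in> L2"
    by (intro model_conj_L2 inner_function_Linf \<Gamma> J fL)
  have circ: "AE z in circle. cmod z = 1"
    by (rule AE_circleI)
  have "model_conj \<Gamma> J f \<in> H2"
  proof (rule H2_from_cinner[OF uL])
    fix m x
    define g where "g z = (cadjoint (\<Lambda> z) \<circ> \<Gamma> z) (z ^ m *\<^sub>C J x)" for z
    have gH: "g \<in> H2"
      using Hinf_apply_H2[OF le(1)[unfolded inner_le_def] H2_power[OF H2_const]]
      by (simp add: g_def[abs_def])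
    have \<Lambda>g: "(\<lambda>z. \<Lambda> z (g z)) \<in> L2"
      using Linf_apply_L2[OF inner_function_Linf[OF \<Lambda>] H2_L2[OF gH]] .
    note [measurable] = L2_measurable[OF uL] L2_measurable[OF fL] L2_measurable[OF \<Lambda>g]
    have "(LINT z|circle. z ^ Suc m * cinner (model_conj \<Gamma> J f z) x)
        = (LINT z|circle. cnj (cinner (f z) (\<Lambda> z (g z))))"
    proof (rule integral_cong_AE)
      show "AE z in circle. z ^ Suc m * cinner (model_conj \<Gamma> J f z) x = cnj (cinner (f z) (\<Lambda> z (g z)))"
        using circ inner_function_unitary[OF \<Gamma>] inner_function_unitary[OF \<Lambda>] symmetric_wrt_swap[OF J sym]
      proof eventually_elim
        case (elim z)
        note G = unitaryD[OF elim(2)]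
        have "cinner (\<Gamma> z (J (f z))) x = cinner (J (cadjoint (\<Gamma> z) (f z))) x"
          using elim(4) by simp
        also have "\<dots> = cinner (\<Gamma> z (J x)) (f z)"
          by (simp add: conjugationD(5)[OF J, of _ x] cinner_cadjoint[OF G(1)])
        finally have "z ^ Suc m * cinner (model_conj \<Gamma> J f z) x = (z * cnj z) * (z ^ m * cinner (\<Gamma> z (J x)) (f z))"
          by (simp add: model_conj_def bounded_clinear_scaleC[OF G(1)] cinner_scaleC_left)
        also have "\<dots> = cinner (\<Gamma> z (z ^ m *\<^sub>C J x)) (f z)"
          by (simp add: on_circle[OF elim(1)] bounded_clinear_scaleC[OF G(1)] cinner_scaleC_left)
        also have "\<Gamma> z (z ^ m *\<^sub>C J x) = \<Lambda> z (g z)"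
          by (simp add: g_def unitaryD(3)[OF elim(3)])
        finally show ?case
          by (metis cinner_commute)
      qed
    qed measurable
    also have "\<dots> = 0"
      unfolding Bochner_Integration.integral_cnj using orth[OF gH] by (simp add: L2_inner_def)
    finally show "(LINT z|circle. z ^ Suc m * cinner (model_conj \<Gamma> J f z) x) = 0" .
  qed
  moreover have "L2_inner (model_conj \<Gamma> J f) (\<lambda>z. \<Theta> z (g z)) = 0" if g: "g \<in> H2" for g
  proof -
    define h where "h z = (cadjoint (\<Gamma> z) \<circ> \<Theta> z) (g z)" for z
    have hH: "h \<in> H2"
      using Hinf_apply_H2[OF le(2)[unfolded inner_le_def] g] by (simp add: h_def[abs_def])
    have "(\<lambda>z. \<Theta> z (g z)) \<in> L2"
      using Linf_apply_L2[OF inner_function_Linf[OF \<Theta>] H2_L2[OF g]] .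
    then have "L2_inner (model_conj \<Gamma> J f) (\<lambda>z. \<Theta> z (g z)) = (LINT z|circle. cinner (cnj z *\<^sub>C J (f z)) (h z))"
      unfolding L2_inner_def
      by (intro Bochner_Integration.integral_cong refl)
        (simp add: model_conj_def h_def cinner_cadjoint Linf_bounded_clinear[OF inner_function_Linf[OF \<Gamma>]])
    also have "\<dots> = 0"
      using fH hH J by (rule conjugated_H2_orthogonal)
    finally show ?thesis .
  qed
  ultimately show ?thesis
    by (simp add: model_space_def)
qed

lemma op_fourier_bounded_clinear:
  assumes F: "F \<in> Linf"
  shows "bounded_clinear (op_fourier F 0)"
proof -
  have eq: "op_fourier F 0 x = (LINT z|circle. F z x)" for x
    by (simp add: op_fourier_def fourier_def)
  have int: "integrable circle (\<lambda>z. F z x)" for x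
    using L2_integrable[OF Linf_apply_L2[OF F L2_const]] .
  show ?thesis
  proof (rule bounded_clinearI)
    fix x y
    have "(LINT z|circle. F z (x + y)) = (LINT z|circle. F z x + F z y)"
      by (intro Bochner_Integration.integral_cong refl) (simp add: bounded_clinear_add Linf_bounded_clinear[OF F])
    then show "op_fourier F 0 (x + y) = op_fourier F 0 x + op_fourier F 0 y"
      unfolding eq by (simp add: int)
  next
    fix c x
    have "(LINT z|circle. F z (c *\<^sub>C x)) = (LINT z|circle. c *\<^sub>C F z x)"
      by (intro Bochner_Integration.integral_cong refl) (simp add: bounded_clinear_scaleC Linf_bounded_clinear[OF F])
    also have "\<dots> = c *\<^sub>C (LINT z|circle. F z x)"
      by (intro integral_bounded_linear bounded_bilinear.bounded_linear_right[OF bounded_bilinear_scaleC] int)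
    finally show "op_fourier F 0 (c *\<^sub>C x) = c *\<^sub>C op_fourier F 0 x"
      unfolding eq .
  qed
qed

text \<open>Of the power series at the origin only the constant term remains, since \<open>0 ^ 0 = 1\<close>.\<close>

lemma disc_extension_0: "disc_extension F 0 = op_fourier F 0"
proof
  fix x
  have "(\<lambda>n. (0::complex) ^ n *\<^sub>C op_fourier F (int n) x) sums (\<Sum>n\<in>{0}. (0::complex) ^ n *\<^sub>C op_fourier F (int n) x)"
    by (rule sums_finite) (simp_all add: zero_power)
  from sums_unique[OF this] show "disc_extension F 0 x = op_fourier F 0 x"
    unfolding disc_extension_def
    by (simp only: sum.insert finite.emptyI empty_iff not_False_eq_True sum.empty add_0_right
        power_0 scaleC_one of_nat_0)
qed

text \<open>Subtracting the constant term makes division by \<open>z\<close> harmless for analyticity.  As \<open>\<Lambda>\<close> is isometric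
  on the circle, pairing the backward shift of \<open>\<Lambda> x\<close> with \<open>\<Lambda> g\<close> leaves the pairings of \<open>cnj z x\<close> with \<open>g\<close> and
  of \<open>cnj z \<Lambda>(0) x\<close> with \<open>\<Lambda> g\<close>, which vanish since \<open>g\<close> and \<open>\<Lambda> g\<close> have no negative frequencies.\<close>

lemma backward_shift_model_space:
  assumes \<Lambda>: "inner_function \<Lambda>"
  shows "(\<lambda>z. cnj z *\<^sub>C (\<Lambda> z x - op_fourier \<Lambda> 0 x)) \<in> model_space \<Lambda>" (is "?f \<in> _")
proof -
  let ?x0 = "op_fourier \<Lambda> 0 x"
  have \<Lambda>x: "(\<lambda>z. \<Lambda> z x) \<in> H2"
    using Hinf_H2[OF inner_function_Hinf[OF \<Lambda>]] .
  have dH: "(\<lambda>z. \<Lambda> z x - ?x0) \<in> H2"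
    by (intro H2_diff \<Lambda>x H2_const)
  have fL: "?f \<in> L2"
    by (intro L2_cnj_mult H2_L2 dH)
  have "(LINT z|circle. z ^ Suc m *\<^sub>C ?f z) = 0" for m
  proof -
    have "(LINT z|circle. z ^ Suc m *\<^sub>C ?f z) = (LINT z|circle. z ^ m *\<^sub>C (\<Lambda> z x - ?x0))"
    proof (intro Bochner_Integration.integral_cong refl)
      fix z :: complex assume z: "z \<in> space circle"
      have "z ^ Suc m * cnj z = z ^ m * (z * cnj z)"
        by simp
      then show "z ^ Suc m *\<^sub>C ?f z = z ^ m *\<^sub>C (\<Lambda> z x - ?x0)"
        using z by (simp only: scaleC_scaleC) (simp add: on_circle)
    qed
    also have "\<dots> = 0"
    proof (cases m)
      case 0
      have "(LINT z|circle. \<Lambda> z x - ?x0) = (LINT z|circle. \<Lambda> z x) - (LINT z|circle. ?x0)"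
        by (intro Bochner_Integration.integral_diff L2_integrable H2_L2 \<Lambda>x H2_const)
      also have "\<dots> = 0"
        by (simp add: measure_circle) (simp add: op_fourier_def fourier_def)
      finally show ?thesis
        using 0 by simp
    next
      case (Suc k)
      then show ?thesis
        using dH unfolding H2_iff by blast
    qed
    finally show ?thesis .
  qed
  then have "?f \<in> H2"
    using fL unfolding H2_iff by blast
  moreover have "L2_inner ?f (\<lambda>z. \<Lambda> z (g z)) = 0" if g: "g \<in> H2" for g
  proof -
    have \<Lambda>g: "(\<lambda>z. \<Lambda> z (g z)) \<in> H2"
      using Hinf_apply_H2[OF inner_function_Hinf[OF \<Lambda>] g] .
    have const: "(LINT z|circle. cinner (cnj z *\<^sub>C y) (h z)) = 0" if "h \<in> H2" for h y
    proof -
      have eq: "cinner (cnj z *\<^sub>C y) (h z) = cnj (z ^ Suc 0 * cinner (h z) y)" for z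
        by (simp add: cinner_scaleC_left cinner_commute[of y])
      show ?thesis
        using H2_complex_moment[OF H2_cinner[OF that]] by (simp only: eq Bochner_Integration.integral_cnj complex_cnj_zero)
    qed
    note [measurable] = L2_measurable[OF fL] L2_measurable[OF H2_L2[OF \<Lambda>g]] L2_measurable[OF H2_L2[OF g]]
    have int: "integrable circle (\<lambda>z. cinner (cnj z *\<^sub>C y) (h z))" if "h \<in> H2" for h y
      by (intro integrable_cinner L2_cnj_mult L2_const H2_L2 that)
    have "L2_inner ?f (\<lambda>z. \<Lambda> z (g z))
        = (LINT z|circle. cinner (cnj z *\<^sub>C x) (g z) - cinner (cnj z *\<^sub>C ?x0) (\<Lambda> z (g z)))"
      unfolding L2_inner_def
    proof (rule integral_cong_AE)
      show "AE z in circle. cinner (?f z) (\<Lambda> z (g z))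
          = cinner (cnj z *\<^sub>C x) (g z) - cinner (cnj z *\<^sub>C ?x0) (\<Lambda> z (g z))"
        using inner_function_unitary[OF \<Lambda>]
        by eventually_elim (simp add: cinner_scaleC_left cinner_diff_left right_diff_distrib unitaryD(4))
    qed measurable
    also have "\<dots> = 0"
      by (simp add: int const g \<Lambda>g)
    finally show ?thesis .
  qed
  ultimately show ?thesis
    by (simp add: model_space_def)
qed

text \<open>The functions \<open>(I - \<Lambda> A) x\<close> with \<open>A = J \<Lambda>(0) J\<close> lie in the model space, being images of backward
  shifts under its conjugation, so \<open>X (I - \<Lambda> A)\<close> is analytic.  By purity \<open>A\<close> is a strict contraction, and
  \<open>\<Lambda>\<close> is isometric, so the Neumann series of \<open>I - \<Lambda> A\<close> converges: with \<open>B = \<Lambda> A\<close>, the function \<open>X - X B\<^sup>N\<close> is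
  analytic for every \<open>N\<close> while \<open>X B\<^sup>N\<close> tends to \<open>0\<close> uniformly.\<close>

lemma Hinf_if_maps_model_space:
  assumes \<Lambda>: "inner_function \<Lambda>" and pure: "pure \<Lambda>" and J: "conjugation J" and sym: "symmetric_wrt J \<Lambda>"
    and X: "X \<in> Linf" and maps: "\<And>f. f \<in> model_space \<Lambda> \<Longrightarrow> (\<lambda>z. X z (f z)) \<in> H2"
  shows "X \<in> Hinf"
proof -
  define L where "L = op_fourier \<Lambda> 0"
  have L: "bounded_clinear L"
    unfolding L_def by (intro op_fourier_bounded_clinear inner_function_Linf \<Lambda>)
  define a where "a = onorm L"
  have blL: "bounded_linear L"
    using L by (simp add: bounded_clinear_def)
  have a: "0 \<le> a" "a < 1"
    using pure onorm_pos_le[OF blL] by (simp_all add: a_def L_def pure_def disc_extension_0)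
  define A where "A = J \<circ> L \<circ> J"
  have A: "bounded_clinear A"
    unfolding A_def by (intro conjugation_compose_bounded_clinear L J)
  have A_norm: "norm (A x) \<le> a * norm x" for x
    using onorm[OF blL, of "J x"] by (simp add: A_def a_def conjugationD(7)[OF J])
  define B where "B z = \<Lambda> z \<circ> A" for z
  have B: "B \<in> Hinf"
    using Hinf_compose[OF inner_function_Hinf[OF \<Lambda>] Hinf_const[OF A]] by (simp add: B_def[abs_def])
  have step: "(\<lambda>z x. X z x - (X z \<circ> B z) x) \<in> Hinf"
  proof -
    have lin: "(\<lambda>z x. X z x - (X z \<circ> B z) x) \<in> Linf"
      by (intro Linf_diff Linf_compose X Hinf_Linf B)
    have "(\<lambda>z. X z x - (X z \<circ> B z) x) \<in> H2" for x
    proof (rule H2_cong_AE)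
      show "(\<lambda>z. X z (model_conj \<Lambda> J (\<lambda>z. cnj z *\<^sub>C (\<Lambda> z (J x) - op_fourier \<Lambda> 0 (J x))) z)) \<in> H2"
        using maps[OF model_conj_model_space[OF \<Lambda> \<Lambda> \<Lambda> J sym inner_le_refl[OF \<Lambda>] inner_le_refl[OF \<Lambda>]
          backward_shift_model_space[OF \<Lambda>]]] .
      show "(\<lambda>z. X z x - (X z \<circ> B z) x) \<in> borel_measurable circle"
        using Linf_measurable[OF lin] .
      have circ: "AE z in circle. cmod z = 1"
        by (rule AE_circleI)
      show "AE z in circle. X z (model_conj \<Lambda> J (\<lambda>z. cnj z *\<^sub>C (\<Lambda> z (J x) - op_fourier \<Lambda> 0 (J x))) z)
          = X z x - (X z \<circ> B z) x"
        using circ inner_function_unitary[OF \<Lambda>] symmetric_wrt_swap[OF J sym]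
      proof eventually_elim
        case (elim z)
        have "cnj z *\<^sub>C J (cnj z *\<^sub>C (\<Lambda> z (J x) - L (J x))) = J (\<Lambda> z (J x)) - J (L (J x))"
          by (simp add: conjugationD[OF J] scaleC_scaleC on_circle[OF elim(1)])
        also have "\<dots> = cadjoint (\<Lambda> z) x - A x"
          using elim(3) by (simp add: A_def conjugationD(3)[OF J])
        finally have "model_conj \<Lambda> J (\<lambda>z. cnj z *\<^sub>C (\<Lambda> z (J x) - op_fourier \<Lambda> 0 (J x))) z = x - B z x"
          unfolding model_conj_def L_def[symmetric]
          by (simp add: bounded_clinear_diff[OF unitaryD(1)[OF elim(2)]] unitaryD(3)[OF elim(2)] B_def)
        then show ?case
          using bounded_clinear_diff[OF Linf_bounded_clinear[OF X elim(1)]] by simp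
      qed
    qed
    then show ?thesis
      using lin by (simp add: Hinf_iff)
  qed
  have iter: "(\<lambda>z x. X z x - X z ((B z ^^ N) x)) \<in> Hinf" for N
  proof (induction N)
    case 0
    have "(\<lambda>z x. 0) \<in> Hinf"
      by (intro Hinf_const bounded_clinearI) simp_all
    then show ?case
      by simp
  next
    case (Suc N)
    from Hinf_add[OF step Hinf_compose[OF Suc B]] show ?case
      by (simp add: funpow_Suc_right del: funpow.simps)
  qed
  obtain M where M: "M \<ge> 0" "AE z in circle. \<forall>x. norm (X z x) \<le> M * norm x"
    using Linf_bound[OF X] by blast
  have "(\<lambda>z. X z x) \<in> H2" for x
  proof (rule H2_from_cinner)
    show XL: "(\<lambda>z. X z x) \<in> L2"
      using Linf_apply_L2[OF X L2_const] .
    fix m y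
    let ?I = "LINT z|circle. z ^ Suc m * cinner (X z x) y"
    have bound: "cmod ?I \<le> M * norm x * norm y * a ^ N" for N
    proof -
      define r where "r z = X z x - X z ((B z ^^ N) x)" for z
      have rH: "r \<in> H2"
        using Hinf_H2[OF iter] by (simp add: r_def[abs_def])
      have int: "integrable circle (\<lambda>z. z ^ Suc m * cinner (f z) y)" if "f \<in> L2" for f
        using L2_integrable[OF L2_power[OF L2_cinner[OF that]]] by (simp only: scaleC_complex_def)
      have "?I = ?I - (LINT z|circle. z ^ Suc m * cinner (r z) y)"
        using H2_complex_moment[OF H2_cinner[OF rH]] by simp
      also have "\<dots> = (LINT z|circle. z ^ Suc m * cinner (X z x) y - z ^ Suc m * cinner (r z) y)"
        by (intro Bochner_Integration.integral_diff[symmetric] int XL H2_L2 rH)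
      finally have "cmod ?I = cmod (LINT z|circle. z ^ Suc m * cinner (X z x) y - z ^ Suc m * cinner (r z) y)"
        by (rule arg_cong)
      also have "\<dots> \<le> (LINT z|circle. cmod (z ^ Suc m * cinner (X z x) y - z ^ Suc m * cinner (r z) y))"
        by (rule integral_norm_bound)
      also have "\<dots> \<le> (LINT z|circle. M * norm x * norm y * a ^ N)"
      proof (rule integral_mono_AE)
        show "integrable circle (\<lambda>z. cmod (z ^ Suc m * cinner (X z x) y - z ^ Suc m * cinner (r z) y))"
          by (intro integrable_norm Bochner_Integration.integrable_diff int XL H2_L2 rH)
        have circ: "AE z in circle. cmod z = 1"
          by (rule AE_circleI)
        show "AE z in circle. cmod (z ^ Suc m * cinner (X z x) y - z ^ Suc m * cinner (r z) y)
            \<le> M * norm x * norm y * a ^ N"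
          using circ M(2) inner_function_unitary[OF \<Lambda>]
        proof eventually_elim
          case (elim z)
          have BN: "norm ((B z ^^ N) x) \<le> a ^ N * norm x"
          proof (induction N)
            case (Suc N)
            have "norm ((B z ^^ Suc N) x) \<le> a * norm ((B z ^^ N) x)"
              using A_norm unitaryD(5)[OF elim(3)] by (simp add: B_def)
            also have "\<dots> \<le> a * (a ^ N * norm x)"
              using Suc a(1) by (rule mult_left_mono)
            finally show ?case
              by simp
          qed simp
          have "cmod (z ^ Suc m * cinner (X z x) y - z ^ Suc m * cinner (r z) y)
              = cmod (z ^ Suc m * cinner (X z ((B z ^^ N) x)) y)"
            by (simp add: r_def cinner_diff_left flip: right_diff_distrib)
          also have "\<dots> = cmod (cinner (X z ((B z ^^ N) x)) y)"
            using elim(1) by (simp add: norm_mult norm_power)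
          also have "\<dots> \<le> norm (X z ((B z ^^ N) x)) * norm y"
            by (rule cinner_Cauchy_Schwarz)
          also have "\<dots> \<le> (M * norm ((B z ^^ N) x)) * norm y"
            using elim(2) by (intro mult_right_mono) auto
          also have "\<dots> \<le> (M * (a ^ N * norm x)) * norm y"
            using BN M(1) by (intro mult_right_mono mult_left_mono) auto
          finally show ?case
            by (simp add: mult_ac)
        qed
      qed simp
      also have "\<dots> = M * norm x * norm y * a ^ N"
        by (simp add: measure_circle)
      finally show ?thesis .
    qed
    have "(\<lambda>N. M * norm x * norm y * a ^ N) \<longlonglongrightarrow> M * norm x * norm y * 0"
      using a by (intro tendsto_mult_left LIMSEQ_realpow_zero) auto
    then have "cmod ?I \<le> M * norm x * norm y * 0"
      by (rule LIMSEQ_le_const) (use bound in auto)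
    then show "?I = 0"
      by simp
  qed
  then show ?thesis
    using X by (simp add: Hinf_iff)
qed

section \<open>Conjugations intertwining multiplication by the variable and its conjugate\<close>

lemma L2_conjugation_power:
  assumes C: "L2_conjugation C" and comm: "\<forall>f\<in>L2. eq_ae (C (Mz f)) (Mzbar (C f))" and f: "f \<in> L2"
  shows "AE z in circle. C (\<lambda>z. z ^ n *\<^sub>C f z) z = cnj z ^ n *\<^sub>C C f z"
proof (induction n)
  case (Suc n)
  have "Mz (\<lambda>z. z ^ n *\<^sub>C f z) = (\<lambda>z. z ^ Suc n *\<^sub>C f z)"
    by (simp add: Mz_def scaleC_scaleC)
  then have "AE z in circle. C (\<lambda>z. z ^ Suc n *\<^sub>C f z) z = cnj z *\<^sub>C C (\<lambda>z. z ^ n *\<^sub>C f z) z"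
    using comm L2_power[OF f, of n] unfolding eq_ae_def Mzbar_def by metis
  then show ?case
    using Suc by eventually_elim (simp add: scaleC_scaleC)
qed simp

text \<open>Testing against all \<open>z\<^sup>n\<close> turns the integral identity \<open>\<langle>C f, C g\<rangle> = \<langle>g, f\<rangle>\<close> into equality of all Fourier
  coefficients of two integrable functions, hence into a pointwise identity.\<close>

lemma L2_conjugation_pointwise:
  assumes C: "L2_conjugation C" and comm: "\<forall>f\<in>L2. eq_ae (C (Mz f)) (Mzbar (C f))"
    and f: "f \<in> L2" and g: "g \<in> L2"
  shows "AE z in circle. cinner (C f z) (C g z) = cinner (g z) (f z)"
proof -
  have CL: "C h \<in> L2" if "h \<in> L2" for h
    using C that unfolding L2_conjugation_def by blast
  define G where "G z = cinner (C f z) (C g z) - cinner (g z) (f z)" for z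
  have int: "integrable circle (\<lambda>z. a z * cinner (u z) (v z))"
    if "u \<in> L2" "v \<in> L2" "a \<in> borel_measurable circle" "\<And>z. cmod z = 1 \<Longrightarrow> cmod (a z) \<le> 1" for a u v
    using integrable_cinner[OF L2_scaleC_bounded[OF that(1,3,4)] that(2)] by (simp add: cinner_scaleC_left)
  have key: "(LINT z|circle. (cnj z ^ m * z ^ n) * G z) = 0" for m n
  proof -
    have f': "(\<lambda>z. z ^ m *\<^sub>C f z) \<in> L2" and g': "(\<lambda>z. z ^ n *\<^sub>C g z) \<in> L2"
      using L2_power f g by blast+
    have meas: "(\<lambda>z. cnj z ^ m * z ^ n) \<in> borel_measurable circle"
      by measurable
    have le: "cmod (cnj z ^ m * z ^ n) \<le> 1" if "cmod z = 1" for z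
      using that by (simp add: norm_mult norm_power)
    note [measurable] = meas L2_measurable[OF CL[OF f']] L2_measurable[OF CL[OF g']]
      L2_measurable[OF CL[OF f]] L2_measurable[OF CL[OF g]]
    have "(LINT z|circle. (cnj z ^ m * z ^ n) * cinner (C f z) (C g z))
        = L2_inner (C (\<lambda>z. z ^ m *\<^sub>C f z)) (C (\<lambda>z. z ^ n *\<^sub>C g z))"
      unfolding L2_inner_def
    proof (rule integral_cong_AE)
      show "AE z in circle. (cnj z ^ m * z ^ n) * cinner (C f z) (C g z)
          = cinner (C (\<lambda>z. z ^ m *\<^sub>C f z) z) (C (\<lambda>z. z ^ n *\<^sub>C g z) z)"
        using L2_conjugation_power[OF C comm f, of m] L2_conjugation_power[OF C comm g, of n]
        by eventually_elim (simp add: cinner_scaleC_left cinner_scaleC_right mult.assoc)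
    qed measurable
    also have "\<dots> = L2_inner (\<lambda>z. z ^ n *\<^sub>C g z) (\<lambda>z. z ^ m *\<^sub>C f z)"
      using C f' g' unfolding L2_conjugation_def by blast
    also have "\<dots> = (LINT z|circle. (cnj z ^ m * z ^ n) * cinner (g z) (f z))"
      unfolding L2_inner_def by (simp add: cinner_scaleC_left cinner_scaleC_right mult_ac)
    finally show ?thesis
      unfolding G_def right_diff_distrib
      by (subst Bochner_Integration.integral_diff)
        (simp_all add: int[OF CL[OF f] CL[OF g] meas le] int[OF g f meas le])
  qed
  have "AE z in circle. G z = 0"
  proof (rule AE_zero_if_moments_zero)
    show "integrable circle G"
      unfolding G_def[abs_def] by (intro Bochner_Integration.integrable_diff integrable_cinner CL f g)
    show "(LINT z|circle. z ^ n * G z) = 0" for n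
      using key[of 0 n] by simp
    show "(LINT z|circle. cnj z ^ n * G z) = 0" for n
      using key[of n 0] by simp
  qed
  then show ?thesis
    by eventually_elim (simp add: G_def)
qed

text \<open>Such a conjugation acts fibrewise: on constants it is given by the images \<open>g b\<close> of a basis,
  which are orthonormal almost everywhere, and the pointwise inner products identify \<open>C f\<close> with the
  antilinear extension evaluated at \<open>f\<close>.\<close>

lemma L2_conjugation_fibrewise:
  fixes C :: "(complex \<Rightarrow> 'h::fd_complex_hilbert) \<Rightarrow> complex \<Rightarrow> 'h"
  assumes C: "L2_conjugation C" and comm: "\<forall>f\<in>L2. eq_ae (C (Mz f)) (Mzbar (C f))"
  obtains c :: "complex \<Rightarrow> 'h \<Rightarrow> 'h" where "\<And>x. (\<lambda>z. c z x) \<in> borel_measurable circle"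
    and "\<And>z x y. c z (x + y) = c z x + c z y" and "\<And>z a x. c z (a *\<^sub>C x) = cnj a *\<^sub>C c z x"
    and "AE z in circle. conjugation (c z)"
    and "\<And>f. f \<in> L2 \<Longrightarrow> AE z in circle. C f z = c z (f z)"
proof -
  have CL: "C h \<in> L2" if "h \<in> L2" for h
    using C that unfolding L2_conjugation_def by blast
  obtain E :: "'h set" where E: "orthonormal_basis E"
    using orthonormal_basis_exists by blast
  then have fin: "finite E" and on: "\<And>a b. a \<in> E \<Longrightarrow> b \<in> E \<Longrightarrow> cinner a b = (if a = b then 1 else 0)"
    and expand: "\<And>x. (\<Sum>e\<in>E. cinner x e *\<^sub>C e) = x"
    unfolding orthonormal_basis_def by (blast, blast, metis)
  define g where "g b = C (\<lambda>z. b)" for b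
  have gL: "g b \<in> L2" for b
    unfolding g_def by (intro CL L2_const)
  define c where "c z x = (\<Sum>b\<in>E. cinner b x *\<^sub>C g b z)" for z x
  have add: "c z (x + y) = c z x + c z y" for z x y
    by (simp add: c_def cinner_add_right scaleC_add_left sum.distrib)
  have scale: "c z (a *\<^sub>C x) = cnj a *\<^sub>C c z x" for z a x
    by (simp add: c_def cinner_scaleC_right scaleC_sum_right scaleC_scaleC)
  have isom: "AE z in circle. \<forall>x y. cinner (c z x) (c z y) = cinner y x"
  proof -
    have "AE z in circle. cinner (g a z) (g b z) = cinner b a" for a b
      using L2_conjugation_pointwise[OF C comm L2_const L2_const] unfolding g_def .
    then have "AE z in circle. \<forall>a\<in>E. \<forall>b\<in>E. cinner (g a z) (g b z) = cinner b a"
      using fin by (intro AE_finite_allI) auto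
    then show ?thesis
    proof eventually_elim
      case (elim z)
      have "cinner (c z x) (c z y) = cinner y x" for x y
      proof -
        have "cinner (c z x) (c z y) = (\<Sum>a\<in>E. \<Sum>b\<in>E. if b = a then cinner a x * cinner y a else 0)"
          unfolding c_def cinner_sum_left cinner_sum_right
          by (intro sum.cong refl)
            (use elim in \<open>auto simp: on cinner_scaleC_left cinner_scaleC_right simp flip: cinner_commute\<close>)
        also have "\<dots> = (\<Sum>a\<in>E. cinner y a * cinner a x)"
          using fin by (simp add: mult.commute)
        also have "\<dots> = cinner y x"
          by (rule orthonormal_basis_cinner[OF E, symmetric])
        finally show ?thesis .
      qed
      then show ?case
        by blast
    qed
  qed
  have fibre: "AE z in circle. C f z = c z (f z)" if f: "f \<in> L2" for f
  proof -
    have "AE z in circle. cinner (C f z) (g b z) = cinner b (f z)" for b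
      using L2_conjugation_pointwise[OF C comm f L2_const] unfolding g_def .
    then have "AE z in circle. \<forall>b\<in>E. cinner (C f z) (g b z) = cinner b (f z)"
      using fin by (intro AE_finite_allI) auto
    with L2_conjugation_pointwise[OF C comm f f] isom show ?thesis
    proof eventually_elim
      case (elim z)
      have vw: "cinner (C f z) (c z (f z)) = cinner (f z) (f z)"
      proof -
        have "cinner (C f z) (c z (f z)) = (\<Sum>b\<in>E. cinner (f z) b * cinner b (f z))"
          unfolding c_def cinner_sum_right cinner_scaleC_right
          by (intro sum.cong refl) (use elim in \<open>simp flip: cinner_commute\<close>)
        then show ?thesis
          using orthonormal_basis_cinner[OF E, of "f z" "f z"] by simp
      qed
      then have wv: "cinner (c z (f z)) (C f z) = cinner (f z) (f z)"
        by (metis cinner_commute)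
      have "cinner (C f z - c z (f z)) (C f z - c z (f z)) = 0"
        using elim vw wv by (simp add: cinner_diff_left cinner_diff_right)
      then show ?case
        by (simp add: cinner_self)
    qed
  qed
  have "AE z in circle. c z (c z b) = b" if "b \<in> E" for b
  proof -
    have "AE z in circle. C (g b) z = b"
      using C L2_const[of b] unfolding L2_conjugation_def eq_ae_def g_def by blast
    moreover have "AE z in circle. g b z = c z b"
      using fibre[OF L2_const, of b] unfolding g_def .
    ultimately show ?thesis
      using fibre[OF gL[of b]] by eventually_elim simp
  qed
  then have "AE z in circle. \<forall>b\<in>E. c z (c z b) = b"
    using fin by (intro AE_finite_allI) auto
  then have "AE z in circle. conjugation (c z)"
    using isom
  proof eventually_elim
    case (elim z)
    have "c z (c z x) = x" for x
    proof -
      have "c z (c z (\<Sum>e\<in>E. cinner x e *\<^sub>C e)) = (\<Sum>e\<in>E. cinner x e *\<^sub>C c z (c z e))"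
        using clinear_sum[of "\<lambda>x. c z (c z x)" "\<lambda>e. cinner x e" "\<lambda>e. e" E] by (simp add: add scale)
      also have "\<dots> = (\<Sum>e\<in>E. cinner x e *\<^sub>C e)"
        using elim by simp
      finally show ?thesis
        unfolding expand .
    qed
    then show ?case
      using elim unfolding conjugation_def by (simp add: add scale)
  qed
  moreover have "(\<lambda>z. c z x) \<in> borel_measurable circle" for x
    unfolding c_def by (intro borel_measurable_sum borel_measurable_scaleC borel_measurable_const L2_measurable[OF gL])
  ultimately show ?thesis
    using that add scale fibre by blast
qed

lemma conjugation_product_unitary:
  assumes c: "conjugation c" and J: "conjugation J" and z: "cmod z = 1"
  shows "unitary (\<lambda>x. z *\<^sub>C c (J x))" and "J \<circ> (\<lambda>x. z *\<^sub>C c (J x)) \<circ> J = cadjoint (\<lambda>x. z *\<^sub>C c (J x))"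
proof -
  let ?U = "\<lambda>x. z *\<^sub>C c (J x)"
  have U: "bounded_clinear ?U"
    by (rule bounded_clinearI) (simp_all add: conjugationD[OF c] conjugationD[OF J] scaleC_add_right
        scaleC_scaleC mult.commute)
  have "cadjoint ?U = J \<circ> ?U \<circ> J"
  proof (rule cadjoint_eqI[OF U])
    fix x y
    show "cinner (?U x) y = cinner x ((J \<circ> ?U \<circ> J) y)"
      by (simp add: conjugationD(3)[OF J] conjugationD(6)[OF J, of x] cinner_scaleC_left
          conjugationD(5)[OF c, of "J x"])
  qed
  then show adj: "J \<circ> ?U \<circ> J = cadjoint ?U"
    by simp
  show "unitary ?U"
    unfolding unitary_def adj[symmetric] using U
    by (simp add: fun_eq_iff conjugationD(2,3)[OF c] conjugationD(3)[OF J] scaleC_scaleC on_circle[OF z])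
qed

text \<open>Any conjugation \<open>J\<close> of the fibre will do: \<open>\<Gamma> z = z C\<^sub>z J\<close>, where \<open>C\<^sub>z\<close> is the action of \<open>C\<close> on the fibre
  over \<open>z\<close>, is \<open>J\<close>-symmetric because \<open>C\<^sub>z\<close> and \<open>J\<close> are involutions.\<close>

lemma L2_conjugation_model_conj:
  fixes C :: "(complex \<Rightarrow> 'h::fd_complex_hilbert) \<Rightarrow> complex \<Rightarrow> 'h"
  assumes C: "L2_conjugation C" and comm: "\<forall>f\<in>L2. eq_ae (C (Mz f)) (Mzbar (C f))" and J: "conjugation J"
  obtains \<Gamma> where "\<Gamma> \<in> Linf" and "AE z in circle. unitary (\<Gamma> z)" and "symmetric_wrt J \<Gamma>"
    and "\<forall>f\<in>L2. eq_ae (C f) (model_conj \<Gamma> J f)"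
proof -
  obtain c :: "complex \<Rightarrow> 'h \<Rightarrow> 'h" where meas: "\<And>x. (\<lambda>z. c z x) \<in> borel_measurable circle"
    and add: "\<And>z x y. c z (x + y) = c z x + c z y" and scale: "\<And>z a x. c z (a *\<^sub>C x) = cnj a *\<^sub>C c z x"
    and conj: "AE z in circle. conjugation (c z)"
    and fibre: "\<And>f. f \<in> L2 \<Longrightarrow> AE z in circle. C f z = c z (f z)"
    using L2_conjugation_fibrewise[OF C comm] by blast
  define \<Gamma> where "\<Gamma> z = (\<lambda>x. z *\<^sub>C c z (J x))" for z
  have circ: "AE z in circle. cmod z = 1"
    by (rule AE_circleI)
  have uni: "AE z in circle. unitary (\<Gamma> z)"
    using circ conj by eventually_elim (simp add: \<Gamma>_def conjugation_product_unitary(1)[OF _ J])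
  have "\<Gamma> \<in> Linf"
  proof (rule LinfI)
    show "bounded_clinear (\<Gamma> z)" for z
      unfolding \<Gamma>_def by (rule bounded_clinearI)
        (simp_all add: add scale conjugationD[OF J] scaleC_add_right scaleC_scaleC mult.commute)
    show "(\<lambda>z. \<Gamma> z x) \<in> borel_measurable circle" for x
      unfolding \<Gamma>_def by (intro borel_measurable_scaleC meas) measurable
    show "AE z in circle. \<forall>x. norm (\<Gamma> z x) \<le> 1 * norm x"
      using uni by eventually_elim (simp add: unitaryD(5))
  qed
  moreover have "symmetric_wrt J \<Gamma>"
    unfolding symmetric_wrt_def using circ conj
    by eventually_elim (simp only: \<Gamma>_def conjugation_product_unitary(2)[OF _ J])
  moreover have "\<forall>f\<in>L2. eq_ae (C f) (model_conj \<Gamma> J f)"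
  proof
    fix f :: "complex \<Rightarrow> 'h" assume "f \<in> L2"
    from circ fibre[OF this] show "eq_ae (C f) (model_conj \<Gamma> J f)"
      unfolding eq_ae_def
      by eventually_elim
        (simp add: model_conj_def \<Gamma>_def conjugationD(2,3)[OF J] scale scaleC_scaleC on_circle)
  qed
  ultimately show ?thesis
    using that uni by blast
qed

section \<open>Conjugations between model spaces\<close>

theorem theorem7p3:
  fixes \<Theta> \<Lambda> :: "complex \<Rightarrow> 'h::fd_complex_hilbert \<Rightarrow> 'h"
    and C :: "(complex \<Rightarrow> 'h) \<Rightarrow> complex \<Rightarrow> 'h"
  assumes "inner_function \<Theta>" and "pure \<Theta>"
    and "inner_function \<Lambda>" and "pure \<Lambda>"
    and "\<exists>J. conjugation J \<and> symmetric_wrt J \<Theta>"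
    and "\<exists>J. conjugation J \<and> symmetric_wrt J \<Lambda>"
    and "L2_conjugation C"
    and "\<forall>f\<in>L2. eq_ae (C (Mz f)) (Mzbar (C f))"
  shows "(C ` model_space \<Lambda> \<subseteq> model_space \<Theta> \<longleftrightarrow>
      (\<exists>\<Gamma> J. inner_function \<Gamma> \<and> conjugation J \<and> inner_le \<Lambda> \<Gamma> \<and> inner_le \<Gamma> \<Theta> \<and>
        symmetric_wrt J \<Gamma> \<and> (\<forall>f\<in>L2. eq_ae (C f) (model_conj \<Gamma> J f))))
    \<and> (C ` model_space \<Lambda> \<subseteq> model_space \<Theta> \<longrightarrow> inner_le \<Lambda> \<Theta>)"
proof -
  note \<Theta> = assms(1) and \<Lambda> = assms(3) and C = assms(7) and comm = assms(8)
  obtain J' where J': "conjugation J'" and sym': "symmetric_wrt J' \<Theta>"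
    using assms(5) by blast
  obtain J where J: "conjugation J" and symL: "symmetric_wrt J \<Lambda>"
    using assms(6) by blast
  have circ: "AE z in circle. cmod z = 1"
    by (rule AE_circleI)
  have CL: "C f \<in> L2" if "f \<in> L2" for f
    using C that unfolding L2_conjugation_def by blast
  have model_L2: "f \<in> L2" if "f \<in> model_space F" for f and F :: "complex \<Rightarrow> 'h \<Rightarrow> 'h"
    using that by (simp add: model_space_def H2_L2)
  have sufficient: "C ` model_space \<Lambda> \<subseteq> model_space \<Theta>"
    if \<Gamma>: "inner_function \<Gamma>" "conjugation K" "inner_le \<Lambda> \<Gamma>" "inner_le \<Gamma> \<Theta>" "symmetric_wrt K \<Gamma>"
      and C_eq: "\<forall>f\<in>L2. eq_ae (C f) (model_conj \<Gamma> K f)" for \<Gamma> K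
  proof
    fix u assume "u \<in> C ` model_space \<Lambda>"
    then obtain f where f: "f \<in> model_space \<Lambda>" and u: "u = C f"
      by blast
    have "AE z in circle. model_conj \<Gamma> K f z = C f z"
      using C_eq model_L2[OF f] unfolding eq_ae_def by (auto elim: eventually_mono)
    then show "u \<in> model_space \<Theta>"
      unfolding u using model_conj_model_space[OF \<Theta> \<Lambda> \<Gamma>(1,2,5,3,4) f]
      by (intro model_space_cong_AE[OF _ \<Theta> L2_measurable[OF CL[OF model_L2[OF f]]]])
  qed
  have necessary: "\<exists>\<Gamma>. inner_function \<Gamma> \<and> inner_le \<Lambda> \<Gamma> \<and> inner_le \<Gamma> \<Theta> \<and> symmetric_wrt J \<Gamma> \<and>
      (\<forall>f\<in>L2. eq_ae (C f) (model_conj \<Gamma> J f)) \<and> inner_le \<Lambda> \<Theta>"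
    if maps: "C ` model_space \<Lambda> \<subseteq> model_space \<Theta>"
  proof -
    obtain \<Gamma> where \<Gamma>: "\<Gamma> \<in> Linf" and uni: "AE z in circle. unitary (\<Gamma> z)" and sym: "symmetric_wrt J \<Gamma>"
      and C_eq: "\<forall>f\<in>L2. eq_ae (C f) (model_conj \<Gamma> J f)"
      using L2_conjugation_model_conj[OF C comm J] by blast
    have C_ae: "AE z in circle. C f z = model_conj \<Gamma> J f z" if "f \<in> L2" for f
      using C_eq that unfolding eq_ae_def by blast
    note \<Theta>_inf = inner_function_Linf[OF \<Theta>] and \<Lambda>_inf = inner_function_Linf[OF \<Lambda>]
    note \<Theta>_uni = inner_function_unitary[OF \<Theta>] and \<Lambda>_uni = inner_function_unitary[OF \<Lambda>]
    \<comment> \<open>multiplication by \<open>W\<close> is \<open>C\<close> after the conjugation of the model space of \<open>\<Lambda>\<close>\<close>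
    define W where "W z = \<Gamma> z \<circ> cadjoint (\<Lambda> z)" for z
    have W_inf: "W \<in> Linf"
      using Linf_compose[OF \<Gamma> Linf_cadjoint[OF \<Lambda>_inf]] by (simp add: W_def[abs_def])
    have W: "W \<in> Hinf"
    proof (rule Hinf_if_maps_model_space[OF \<Lambda> assms(4) J symL W_inf])
      fix f assume f: "f \<in> model_space \<Lambda>"
      define u where "u = model_conj \<Lambda> J f"
      have u: "u \<in> model_space \<Lambda>"
        unfolding u_def by (intro model_conj_model_space[OF \<Lambda> \<Lambda> \<Lambda> J symL] inner_le_refl \<Lambda> f)
      then have "C u \<in> H2"
        using maps by (auto simp: model_space_def)
      moreover have "(\<lambda>z. W z (f z)) \<in> borel_measurable circle"
        using Linf_apply_measurable[OF W_inf L2_measurable[OF model_L2[OF f]]] .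
      moreover have "AE z in circle. C u z = W z (f z)"
        using C_ae[OF model_L2[OF u]] circ uni \<Lambda>_uni symmetric_wrt_swap[OF J symL]
      proof eventually_elim
        case (elim z)
        have "cnj z *\<^sub>C J (\<Lambda> z (cnj z *\<^sub>C J (f z))) = J (\<Lambda> z (J (f z)))"
          by (simp add: bounded_clinear_scaleC[OF unitaryD(1)[OF elim(4)]] conjugationD(2)[OF J]
              scaleC_scaleC on_circle[OF elim(2)])
        also have "\<dots> = cadjoint (\<Lambda> z) (f z)"
          using elim(5) by (simp add: conjugationD(3)[OF J])
        finally show ?case
          unfolding elim(1) by (simp add: u_def model_conj_def W_def)
      qed
      ultimately show "(\<lambda>z. W z (f z)) \<in> H2"
        by (rule H2_cong_AE)
    qed
    have "\<Gamma> \<in> Hinf"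
    proof (rule Hinf_cong_AE[OF Hinf_compose[OF W inner_function_Hinf[OF \<Lambda>]] \<Gamma>])
      show "AE z in circle. W z \<circ> \<Lambda> z = \<Gamma> z"
        using \<Lambda>_uni by eventually_elim (simp add: W_def fun_eq_iff unitaryD(2))
    qed
    then have \<Gamma>_inner: "inner_function \<Gamma>"
      using uni by (simp add: inner_function_def)
    have le1: "inner_le \<Lambda> \<Gamma>"
      unfolding inner_le_def
    proof (rule Hinf_cong_AE[OF Hinf_conjugated_cadjoint[OF W J J]])
      show "(\<lambda>z. cadjoint (\<Lambda> z) \<circ> \<Gamma> z) \<in> Linf"
        by (intro Linf_compose Linf_cadjoint \<Lambda>_inf \<Gamma>)
      show "AE z in circle. J \<circ> cadjoint (W z) \<circ> J = cadjoint (\<Lambda> z) \<circ> \<Gamma> z"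
        using uni \<Lambda>_uni symmetric_wrt_swap[OF J sym] symmetric_wrt_swap[OF J symL]
      proof eventually_elim
        case (elim z)
        have "cadjoint (W z) = \<Lambda> z \<circ> cadjoint (\<Gamma> z)"
          unfolding W_def using unitaryD(1)[OF elim(1)] unitaryD(1)[OF elim(2)]
          by (intro cadjoint_eqI bounded_clinear_compose bounded_clinear_cadjoint)
            (simp_all add: cinner_cadjoint cinner_cadjoint_left)
        moreover have "J (\<Lambda> z (cadjoint (\<Gamma> z) (J x))) = cadjoint (\<Lambda> z) (\<Gamma> z x)" for x
        proof -
          have "\<Gamma> z x = J (cadjoint (\<Gamma> z) (J x))"
            using elim(3) by (metis conjugationD(3)[OF J])
          then have "cadjoint (\<Gamma> z) (J x) = J (\<Gamma> z x)"
            by (simp add: conjugationD(3)[OF J])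
          then show ?thesis
            using elim(4) by (simp add: conjugationD(3)[OF J])
        qed
        ultimately show ?case
          by (simp add: fun_eq_iff)
      qed
    qed
    \<comment> \<open>multiplication by \<open>V\<close> is \<open>C\<close> followed by the conjugation of the model space of \<open>\<Theta>\<close>\<close>
    define V where "V z = \<Theta> z \<circ> (J' \<circ> J) \<circ> cadjoint (\<Gamma> z)" for z
    have JJ: "bounded_clinear (J' \<circ> J)"
      by (rule bounded_clinearI) (simp_all add: conjugationD[OF J] conjugationD[OF J'])
    have V_inf: "V \<in> Linf"
      using Linf_compose[OF Linf_compose[OF \<Theta>_inf Linf_const[OF JJ]] Linf_cadjoint[OF \<Gamma>]]
      by (simp add: V_def[abs_def])
    have V: "V \<in> Hinf"
    proof (rule Hinf_if_maps_model_space[OF \<Lambda> assms(4) J symL V_inf])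
      fix f assume f: "f \<in> model_space \<Lambda>"
      have Cf: "C f \<in> model_space \<Theta>"
        using maps f by blast
      have "model_conj \<Theta> J' (C f) \<in> model_space \<Theta>"
        by (intro model_conj_model_space[OF \<Theta> \<Theta> \<Theta> J' sym'] inner_le_refl \<Theta> Cf)
      then have "model_conj \<Theta> J' (C f) \<in> H2"
        by (simp add: model_space_def)
      moreover have "(\<lambda>z. V z (f z)) \<in> borel_measurable circle"
        using Linf_apply_measurable[OF V_inf L2_measurable[OF model_L2[OF f]]] .
      moreover have "AE z in circle. model_conj \<Theta> J' (C f) z = V z (f z)"
        using C_ae[OF model_L2[OF f]] circ uni symmetric_wrt_swap[OF J sym]
      proof eventually_elim
        case (elim z)
        have "cnj z *\<^sub>C J' (C f z) = J' (\<Gamma> z (J (f z)))"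
          unfolding elim(1) model_conj_def
          by (simp add: bounded_clinear_scaleC[OF unitaryD(1)[OF elim(3)]] conjugationD(2)[OF J']
              scaleC_scaleC on_circle[OF elim(2)])
        then show ?case
          using elim(4) by (simp add: model_conj_def V_def)
      qed
      ultimately show "(\<lambda>z. V z (f z)) \<in> H2"
        by (rule H2_cong_AE)
    qed
    have le2: "inner_le \<Gamma> \<Theta>"
      unfolding inner_le_def
    proof (rule Hinf_cong_AE[OF Hinf_conjugated_cadjoint[OF V J J']])
      show "(\<lambda>z. cadjoint (\<Gamma> z) \<circ> \<Theta> z) \<in> Linf"
        by (intro Linf_compose Linf_cadjoint \<Theta>_inf \<Gamma>)
      show "AE z in circle. J \<circ> cadjoint (V z) \<circ> J' = cadjoint (\<Gamma> z) \<circ> \<Theta> z"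
        using uni \<Theta>_uni symmetric_wrt_swap[OF J sym] symmetric_wrt_swap[OF J' sym']
      proof eventually_elim
        case (elim z)
        note G = unitaryD(1)[OF elim(1)] and T = unitaryD(1)[OF elim(2)]
        have "cadjoint (V z) = \<Gamma> z \<circ> (J \<circ> J') \<circ> cadjoint (\<Theta> z)"
        proof (rule cadjoint_eqI)
          show "bounded_clinear (V z)"
            unfolding V_def by (intro bounded_clinear_compose bounded_clinear_cadjoint JJ G T)
          fix x y
          have "cinner (V z x) y = cinner (J' (J (cadjoint (\<Gamma> z) x))) (cadjoint (\<Theta> z) y)"
            by (simp add: V_def cinner_cadjoint[OF T])
          also have "\<dots> = cinner (cadjoint (\<Gamma> z) x) (J (J' (cadjoint (\<Theta> z) y)))"
            by (metis conjugationD(5)[OF J'] conjugationD(6)[OF J])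
          finally show "cinner (V z x) y = cinner x ((\<Gamma> z \<circ> (J \<circ> J') \<circ> cadjoint (\<Theta> z)) y)"
            by (simp add: cinner_cadjoint_left[OF G])
        qed
        moreover have "J (\<Gamma> z (J (J' (cadjoint (\<Theta> z) (J' x))))) = cadjoint (\<Gamma> z) (\<Theta> z x)" for x
        proof -
          have "\<Theta> z x = J' (cadjoint (\<Theta> z) (J' x))"
            using elim(4) by (metis conjugationD(3)[OF J'])
          then show ?thesis
            using elim(3) by (simp add: conjugationD(3)[OF J])
        qed
        ultimately show ?case
          by (simp add: fun_eq_iff)
      qed
    qed
    have "inner_le \<Lambda> \<Theta>"
      unfolding inner_le_def
    proof (rule Hinf_cong_AE[OF Hinf_compose[OF le1[unfolded inner_le_def] le2[unfolded inner_le_def]]])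
      show "(\<lambda>z. cadjoint (\<Lambda> z) \<circ> \<Theta> z) \<in> Linf"
        by (intro Linf_compose Linf_cadjoint \<Theta>_inf \<Lambda>_inf)
      show "AE z in circle. (cadjoint (\<Lambda> z) \<circ> \<Gamma> z) \<circ> (cadjoint (\<Gamma> z) \<circ> \<Theta> z) = cadjoint (\<Lambda> z) \<circ> \<Theta> z"
        using uni by eventually_elim (simp add: fun_eq_iff unitaryD(3))
    qed
    then show ?thesis
      using \<Gamma>_inner le1 le2 sym C_eq by blast
  qed
  show ?thesis
    using sufficient necessary J by blast
qed

end
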